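(* The 4-point SBIGS-scheme (spherical angle-based 4-point scheme) on the unit sphere $\mathbb{S}^2$ is not in general $G^2$-continuous: there exists an initial geodesic polygon $P^0$ on $\mathbb{S}^2$ such that the limit curve $C=\lim_{j\to\infty}P^j$ generated by the scheme is not $G^2$-continuous.
   Context: $\mathbb{S}^2\subset\mathbb{R}^3$ is the oriented unit sphere with centre $o$, and $d$ is its geodesic distance. A geodesic polygon $P=(p_i)_{i\in\mathbb{Z}}$ is a sequence of points of $\mathbb{S}^2$ with consecutive points distinct and non-antipodal, consecutive points being joined by the minimizing great-circle arc. For a polygon $P^j=(p_i^j)_{i\in\mathbb{Z}}$ let $l_{i,i+1}^j=e_i^j=d(p_i^j,p_{i+1}^j)$, let $c_{i,i+1}^j$ be the unit-speed minimizing geodesic from $p_i^j$ to $p_{i+1}^j$, and put $U_i^j=\dot c_{i,i+1}^j(0)$ and $V_i^j=\dot c_{i-1,i}^j(l_{i-1,i}^j)$, two unit vectors in $T_{p_i^j}\mathbb{S}^2$. The signed angular defect at $p_i^j$ is the signed angle $\delta_i^j=\sphericalangle(U_i^j,V_i^j)\in(-\pi,\pi]$ from $U_i^j$ to $V_i^j$, with respect to the orientation of the sphere by its outward normal. 4-point SBIGS-scheme (SBIGS = Spherical Bisector Interpolatory Geometric Subdivision): given $P^j$, the polygon $P^{j+1}$ is defined by $p_{2i}^{j+1}=p_i^j$ and $$p_{2i+1}^{j+1}=R_{\vec n,\,e_{2i}^{j+1}}\big(\overrightarrow{op_i^j}\big),\qquad \vec n=\overrightarrow{op_i^j}\wedge\big(R_{p_i^j,\,\alpha_{2i+1}^{j+1}}U_i^j\big),$$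 $$e_{2i}^{j+1}=\arctan\left(\frac{\tan(l_{i,i+1}^j/2)}{\cos(\alpha_{2i+1}^{j+1})}\right),\qquad \alpha_{2i+1}^{j+1}=\frac{\delta_i^j+\delta_{i+1}^j}{8},$$ where $R_{v,\theta}$ denotes the rotation of $\mathbb{R}^3$ about the oriented axis $v$ by angle $\theta$. Equivalently, $p_{2i+1}^{j+1}$ is the apex of the isosceles spherical triangle with base $p_i^jp_{i+1}^j$ and both signed base angles equal to $\alpha_{2i+1}^{j+1}$ (the midpoint of the arc if this angle is $0$). The limit curve $C$ is the uniform limit of the polygons $P^j$, each parametrized as the curve $c^j:\mathbb{R}\to\mathbb{S}^2$ with $c^j(i/2^j)=p_i^j$ and constant speed on each interval $[i/2^j,(i+1)/2^j]$; for this scheme the limit curve exists and is $G^1$-continuous, i.e. it has at each point a well-defined oriented tangent direction varying continuously along the curve. For points $p_1,p,p_2\in\mathbb{S}^2$ (with $p_1,p_2$ distinct from $p$ and close to $p$), let $c_1$ be the minimizing geodesic from $p_1$ to $p$ and $c_2$ the one from $p$ to $p_2$, with lengths $l_1,l_2$ and unit tangent vectors $u_1,u_2$ at $p$; the discrete geodesic curvature is $\kappa_g(p_1,p,p_2)=\frac{2\delta}{l_1+l_2}$, where $\delta=\sphericalangle(u_1,u_2)\in(-\pi,\pi]$ is the signed angle from $u_1$ to $u_2$. A $G^1$-continuous curve $C$ on $\mathbb{S}^2$ is $G^2$-continuous at $p\in C$ if the (finite) limit $\kappa_g(p):=\lim_{p_1,p_2\to p}\kappa_g(p_1,p,p_2)$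 exists, where $p_1,p_2\in C$, $p_1$ approaches $p$ along the curve from the left and $p_2$ approaches $p$ along the curve from the right. $C$ is $G^2$-continuous if the map $p\in C\mapsto\kappa_g(p)$ is well defined and continuous. *)

theory Defs
  imports "HOL-Analysis.Analysis"
begin

unbundle cross3_syntax

section \<open>Spherical geometry\<close>

text \<open>The unit sphere is \<^term>\<open>sphere (0 :: real^3) 1\<close>; points and tangent vectors are
  elements of \<^typ>\<open>real^3\<close>.\<close>

definition geo_dist :: "real^3 \<Rightarrow> real^3 \<Rightarrow> real" where
  "geo_dist p q = arccos (p \<bullet> q)"

text \<open>Unit-speed great-circle parametrization starting at \<open>p\<close> in the direction of the component of
  \<open>q\<close> orthogonal to \<open>p\<close>. For distinct non-antipodal \<open>p\<close>, \<open>q\<close> on the sphere its restriction to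
  \<open>[0, geo_dist p q]\<close> is the minimizing geodesic from \<open>p\<close> to \<open>q\<close>.\<close>

definition geodesic :: "real^3 \<Rightarrow> real^3 \<Rightarrow> real \<Rightarrow> real^3" where
  "geodesic p q t = cos t *\<^sub>R p + sin t *\<^sub>R sgn (q - (p \<bullet> q) *\<^sub>R p)"

definition start_tangent :: "real^3 \<Rightarrow> real^3 \<Rightarrow> real^3" where
  "start_tangent p q = vector_derivative (geodesic p q) (at 0)"

definition end_tangent :: "real^3 \<Rightarrow> real^3 \<Rightarrow> real^3" where
  "end_tangent p q = vector_derivative (geodesic p q) (at (geo_dist p q))"

text \<open>Rotation about the oriented axis \<open>v\<close> (not necessarily of unit length) by the angle \<open>\<theta>\<close>,
  given by Rodrigues' formula.\<close>

definition rotation :: "real^3 \<Rightarrow> real \<Rightarrow> real^3 \<Rightarrow> real^3" where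
  "rotation v \<theta> x = (let n = sgn v in
     cos \<theta> *\<^sub>R x + sin \<theta> *\<^sub>R (n \<times> x) + ((1 - cos \<theta>) * (n \<bullet> x)) *\<^sub>R n)"

text \<open>For a point \<open>p\<close> of the sphere and unit tangent vectors \<open>u\<close>, \<open>v\<close> at \<open>p\<close>, the numbers
  \<open>u \<bullet> v\<close> and \<open>p \<bullet> (u \<times> v)\<close> are the cosine and the sine of the angle from \<open>u\<close> to \<open>v\<close> in the
  tangent plane oriented by the outward normal \<open>p\<close>; \<^const>\<open>Arg\<close> takes values in \<open>]-pi, pi]\<close>.\<close>

definition signed_angle :: "real^3 \<Rightarrow> real^3 \<Rightarrow> real^3 \<Rightarrow> real" where
  "signed_angle p u v = Arg (Complex (u \<bullet> v) (p \<bullet> (u \<times> v)))"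


section \<open>Geodesic polygons and the 4-point SBIGS-scheme\<close>

definition geodesic_polygon :: "(int \<Rightarrow> real^3) \<Rightarrow> bool" where
  "geodesic_polygon P \<longleftrightarrow>
     (\<forall>i. P i \<in> sphere 0 1 \<and> P i \<noteq> P (i + 1) \<and> P i \<noteq> - P (i + 1))"

text \<open>The angle is measured from the outgoing to the incoming unit tangent.\<close>

definition angular_defect :: "(int \<Rightarrow> real^3) \<Rightarrow> int \<Rightarrow> real" where
  "angular_defect P i =
     signed_angle (P i) (start_tangent (P i) (P (i + 1))) (end_tangent (P (i - 1)) (P i))"

definition sbigs_angle :: "(int \<Rightarrow> real^3) \<Rightarrow> int \<Rightarrow> real" where
  "sbigs_angle P i = (angular_defect P i + angular_defect P (i + 1)) / 8"

definition sbigs_edge :: "(int \<Rightarrow> real^3) \<Rightarrow> int \<Rightarrow> real" where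
  "sbigs_edge P i = arctan (tan (geo_dist (P i) (P (i + 1)) / 2) / cos (sbigs_angle P i))"

definition sbigs_point :: "(int \<Rightarrow> real^3) \<Rightarrow> int \<Rightarrow> real^3" where
  "sbigs_point P i =
     (let n = P i \<times> rotation (P i) (sbigs_angle P i) (start_tangent (P i) (P (i + 1)))
      in rotation n (sbigs_edge P i) (P i))"

definition sbigs_step :: "(int \<Rightarrow> real^3) \<Rightarrow> (int \<Rightarrow> real^3)" where
  "sbigs_step P k = (if even k then P (k div 2) else sbigs_point P (k div 2))"

definition sbigs :: "(int \<Rightarrow> real^3) \<Rightarrow> nat \<Rightarrow> (int \<Rightarrow> real^3)" where
  "sbigs P0 j = (sbigs_step ^^ j) P0"

text \<open>The polygon of level \<open>j\<close> as a curve which takes the value \<open>P i\<close> at \<open>i / 2 ^ j\<close> and traverses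
  the edge from \<open>P i\<close> to \<open>P (i + 1)\<close> with constant speed on \<open>[i / 2 ^ j, (i + 1) / 2 ^ j]\<close>.\<close>

definition polygon_curve :: "nat \<Rightarrow> (int \<Rightarrow> real^3) \<Rightarrow> real \<Rightarrow> real^3" where
  "polygon_curve j P t =
     (let i = \<lfloor>2 ^ j * t\<rfloor>
      in geodesic (P i) (P (i + 1))
           ((2 ^ j * t - of_int i) * geo_dist (P i) (P (i + 1))))"

text \<open>Uniform convergence is taken with respect to the Euclidean distance of \<^typ>\<open>real^3\<close>, which
  on the sphere is uniformly equivalent to the geodesic distance.\<close>

definition sbigs_limit_curve :: "(int \<Rightarrow> real^3) \<Rightarrow> (real \<Rightarrow> real^3) \<Rightarrow> bool" where
  "sbigs_limit_curve P0 c \<longleftrightarrow>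
     uniform_limit UNIV (\<lambda>j. polygon_curve j (sbigs P0 j)) c sequentially"


section \<open>Geometric continuity of curves on the sphere\<close>

text \<open>A curve is given by a parametrization, and "along the curve" refers to the parameter, so that
  different passages through a point of self-intersection are kept apart. The oriented tangent
  direction at \<open>c t\<close> is the common limit of the oriented directions of the secants from \<open>c t\<close>
  forwards and backwards; it does not depend on the speed of the parametrization. Since
  \<^term>\<open>T t\<close> is a unit vector and \<^term>\<open>sgn 0 = 0\<close>, the secants are non-degenerate near \<open>t\<close>.\<close>

definition G1_continuous :: "(real \<Rightarrow> real^3) \<Rightarrow> bool" where
  "G1_continuous c \<longleftrightarrow> continuous_on UNIV c \<and>
     (\<exists>T. continuous_on UNIV T \<and>
       (\<forall>t. norm (T t) = 1 \<and>
            ((\<lambda>s. sgn (c s - c t)) \<longlongrightarrow> T t) (at_right t) \<and>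
            ((\<lambda>s. sgn (c t - c s)) \<longlongrightarrow> T t) (at_left t)))"

text \<open>Here, as opposed to \<^const>\<open>angular_defect\<close>, the angle is measured from the incoming to the
  outgoing unit tangent.\<close>

definition discrete_curvature :: "real^3 \<Rightarrow> real^3 \<Rightarrow> real^3 \<Rightarrow> real" where
  "discrete_curvature p1 p p2 =
     2 * signed_angle p (end_tangent p1 p) (start_tangent p p2) / (geo_dist p1 p + geo_dist p p2)"

definition has_geodesic_curvature :: "(real \<Rightarrow> real^3) \<Rightarrow> real \<Rightarrow> real \<Rightarrow> bool" where
  "has_geodesic_curvature c t k \<longleftrightarrow>
     ((\<lambda>(s1, s2). discrete_curvature (c s1) (c t) (c s2)) \<longlongrightarrow> k) (at_left t \<times>\<^sub>F at_right t)"

text \<open>This notion is meant for curves on the sphere which are \<^const>\<open>G1_continuous\<close>.\<close>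

definition G2_continuous :: "(real \<Rightarrow> real^3) \<Rightarrow> bool" where
  "G2_continuous c \<longleftrightarrow>
     (\<exists>\<kappa>. (\<forall>t. has_geodesic_curvature c t (\<kappa> t)) \<and> continuous_on UNIV \<kappa>)"

end

theory Submission
  imports Defs
begin

text \<open>Why the scheme fails to be \<open>G\<^sup>2\<close>. In terms of angular defects \<open>\<delta>\<close> a refinement step is
  almost linear: at an old vertex the new defect is exactly
  \<open>(-\<delta> (i - 1) + 6 * \<delta> i - \<delta> (i + 1)) / 8\<close>, and at a new vertex, with
  \<open>\<alpha> = (\<delta> i + \<delta> (i + 1)) / 8\<close> and leg \<open>e\<close>, it is \<open>2 * arctan (cos e * tan \<alpha>)\<close>, which in the
  plane would be \<open>2 * \<alpha>\<close> (lemma \<open>isosceles_apex\<close>, by which \<open>framed_polygon_sbigs_step\<close> reduces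
  the geometry to a recursion for lengths and defects). Since edges are roughly halved,
  curvature corresponds to \<open>2 ^ j * \<delta>\<close>, up to a negative factor. At a fixed vertex, the scaled defect and the scaled sum
  of the two neighbouring ones are, in the planar model, transformed by a matrix with a Jordan block for the
  eigenvalue 1, so the scaled defect grows linearly with the level \<open>j\<close> unless the starting
  values are special. The spherical correction has a favourable sign as long as the defects
  involved are nonnegative (\<open>defect_growth\<close>). As edge lengths remain \<open>O(1 / 2 ^ j)\<close>, the
  discrete curvatures computed from three consecutive vertices, which all lie on the limit
  curve, are unbounded and have no limit (\<open>no_curvature\<close>).\<close>

text \<open>Existence of the limit curve and \<open>G\<^sup>1\<close>-continuity rest on geometric decay: defects and
  their differences together shrink by the factor \<open>3/4\<close> per step (\<open>controlled_refine\<close>). So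
  vertices and edge directions converge uniformly to continuous functions (\<open>dyadic_limit\<close>), and
  since secants of the limit are sums of chords with nearly parallel directions, their
  normalizations converge to the limit of the edge directions (locale \<open>dyadic_chords\<close>). The
  initial polygon is a great circle broken at one vertex.\<close>

section \<open>Moving and turning on the sphere\<close>

text \<open>The next three maps are the moves of a traveller on the sphere who stands at \<open>p\<close> and looks
  in the unit tangent direction \<open>w\<close>: walking along the great circle, carrying the direction
  along that walk, and turning on the spot in the oriented tangent plane. Everything the scheme
  does to a polygon is a combination of these moves, so positions never have to be computed in
  coordinates.\<close>

definition arc_point :: "real^3 \<Rightarrow> real^3 \<Rightarrow> real \<Rightarrow> real^3" where
  "arc_point p w t = cos t *\<^sub>R p + sin t *\<^sub>R w"

definition arc_tangent :: "real^3 \<Rightarrow> real^3 \<Rightarrow> real \<Rightarrow> real^3" where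
  "arc_tangent p w t = cos t *\<^sub>R w - sin t *\<^sub>R p"

definition turn :: "real^3 \<Rightarrow> real \<Rightarrow> real^3 \<Rightarrow> real^3" where
  "turn p \<theta> w = cos \<theta> *\<^sub>R w + sin \<theta> *\<^sub>R (p \<times> w)"

definition unit_tangent :: "real^3 \<Rightarrow> real^3 \<Rightarrow> bool" where
  "unit_tangent p w \<longleftrightarrow> norm p = 1 \<and> norm w = 1 \<and> p \<bullet> w = 0"

lemma unit_tangentD:
  assumes "unit_tangent p w"
  shows "p \<bullet> p = 1" "w \<bullet> w = 1" "p \<bullet> w = 0" "w \<bullet> p = 0"
  using assms by (auto simp: unit_tangent_def norm_eq_1 inner_commute)

lemma unit_tangent_cross:
  assumes "unit_tangent p w"
  shows "p \<times> (p \<times> w) = - w" "(p \<times> w) \<times> p = w" "(p \<times> w) \<times> w = - p" "w \<times> (p \<times> w) = p"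
    "(p \<times> w) \<bullet> (p \<times> w) = 1" "p \<bullet> (p \<times> w) = 0" "w \<bullet> (p \<times> w) = 0"
    "(p \<times> w) \<bullet> p = 0" "(p \<times> w) \<bullet> w = 0"
  using unit_tangentD[OF assms] Lagrange[of p p w] cross_skew[of "p \<times> w" p] Lagrange[of w p w] cross_skew[of "p \<times> w" w]
  by (auto simp: dot_cross dot_cross_self inner_commute)

lemma unit_tangent_turn: assumes "unit_tangent p w" shows "unit_tangent p (turn p \<theta> w)"
proof -
  note * = unit_tangentD[OF assms] unit_tangent_cross[OF assms]
  have "turn p \<theta> w \<bullet> turn p \<theta> w = cos \<theta> ^ 2 + sin \<theta> ^ 2"
    unfolding turn_def by (simp add: inner_add * power2_eq_square algebra_simps)
  then show ?thesis
    using * assms by (auto simp: unit_tangent_def norm_eq_1 turn_def inner_add)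
qed

lemma turn_turn: assumes "unit_tangent p w" shows "turn p a (turn p b w) = turn p (a + b) w"
  by (simp add: turn_def cross_add_right cross_mult_right unit_tangent_cross[OF assms] cos_add sin_add
      algebra_simps)

lemma unit_tangent_arc: assumes "unit_tangent p w" shows "unit_tangent (arc_point p w t) (arc_tangent p w t)"
proof -
  note * = unit_tangentD[OF assms]
  have "arc_point p w t \<bullet> arc_point p w t = cos t ^ 2 + sin t ^ 2" "arc_tangent p w t \<bullet> arc_tangent p w t = cos t ^ 2 + sin t ^ 2"
    unfolding arc_point_def arc_tangent_def by (simp_all add: inner_add inner_diff * power2_eq_square algebra_simps)
  then show ?thesis
    using * by (auto simp: unit_tangent_def norm_eq_1 arc_point_def arc_tangent_def inner_add inner_diff)
qed

text \<open>The left normal of a great circle is the same at all its points. Together with the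
  description of turning by means of this normal, it allows turns at different points of an arc
  to be compared.\<close>

lemma cross_arc: assumes "unit_tangent p w" shows "arc_point p w t \<times> arc_tangent p w t = p \<times> w"
proof -
  have "arc_point p w t \<times> arc_tangent p w t = (cos t * cos t) *\<^sub>R (p \<times> w) + (sin t * sin t) *\<^sub>R (p \<times> w)"
    unfolding arc_point_def arc_tangent_def
    using cross_skew[of w p]
    by (simp add: cross_add_left Cross3.right_diff_distrib cross_mult_left cross_mult_right)
  also have "\<dots> = ((cos t)\<^sup>2 + (sin t)\<^sup>2) *\<^sub>R (p \<times> w)"
    by (simp only: scaleR_add_left power2_eq_square)
  finally show ?thesis by simp
qed

lemma geodesic_deriv:
  "(geodesic p q has_vector_derivative arc_tangent p (sgn (q - (p \<bullet> q) *\<^sub>R p)) t) (at t)"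
  unfolding arc_tangent_def geodesic_def
  by (auto intro!: derivative_eq_intros simp: algebra_simps has_real_derivative_iff_has_vector_derivative[symmetric])

context
  fixes p w :: "real^3" and l :: real
  assumes fr: "unit_tangent p w" and l: "0 < l" "l < pi"
begin

lemma inner_arc_point: "p \<bullet> arc_point p w l = cos l"
  using unit_tangentD[OF fr] by (simp add: arc_point_def inner_add)

lemma geo_dist_arc_point: "geo_dist p (arc_point p w l) = l"
  using l by (simp add: geo_dist_def inner_arc_point arccos_cos)

lemma sgn_arc_point: "sgn (arc_point p w l - (p \<bullet> arc_point p w l) *\<^sub>R p) = w"
proof -
  have "arc_point p w l - (p \<bullet> arc_point p w l) *\<^sub>R p = sin l *\<^sub>R w"
    unfolding inner_arc_point by (simp add: arc_point_def)
  then show ?thesis using l fr sin_gt_zero[of l]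
    by (simp add: sgn_scaleR unit_tangent_def sgn_div_norm)
qed

lemma geodesic_arc_point: "geodesic p (arc_point p w l) t = arc_point p w t"
  by (simp only: geodesic_def sgn_arc_point) (simp add: arc_point_def)

lemma start_tangent_arc_point: "start_tangent p (arc_point p w l) = w"
  unfolding start_tangent_def vector_derivative_at[OF geodesic_deriv] sgn_arc_point by (simp add: arc_tangent_def)

lemma end_tangent_arc_point: "end_tangent p (arc_point p w l) = arc_tangent p w l"
  unfolding end_tangent_def vector_derivative_at[OF geodesic_deriv] sgn_arc_point geo_dist_arc_point ..

end

lemma signed_angle_turn_right:
  assumes fr: "unit_tangent p w" and "-pi < \<theta>" "\<theta> \<le> pi"
  shows "signed_angle p w (turn p \<theta> w) = \<theta>"
proof -
  note * = unit_tangentD[OF fr] unit_tangent_cross[OF fr]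
  have "w \<bullet> turn p \<theta> w = cos \<theta>" by (simp add: turn_def inner_add *)
  moreover have "p \<bullet> (w \<times> turn p \<theta> w) = sin \<theta>"
    by (simp add: turn_def inner_add * cross_add_right cross_mult_right)
  ultimately have "signed_angle p w (turn p \<theta> w) = Arg (cis \<theta>)"
    by (simp add: signed_angle_def cis.code)
  then show ?thesis using Arg_cis[of \<theta>] assms by simp
qed

lemma signed_angle_turn_left:
  assumes fr: "unit_tangent p w" and "-pi < \<theta>" "\<theta> < pi"
  shows "signed_angle p (turn p \<theta> w) w = - \<theta>"
  using signed_angle_turn_right[OF unit_tangent_turn[OF fr], of "-\<theta>" \<theta>] assms
  by (simp add: turn_turn[OF fr]) (simp add: turn_def)

lemma rotation_turn: assumes "unit_tangent p w" shows "rotation p \<theta> w = turn p \<theta> w"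
  using assms by (simp add: rotation_def turn_def unit_tangent_def sgn_div_norm)

lemma rotation_arc_point: assumes "unit_tangent p w" shows "rotation (p \<times> w) \<theta> p = arc_point p w \<theta>"
proof -
  have "norm (p \<times> w) = 1" using unit_tangent_cross(5)[OF assms] by (simp add: norm_eq_1)
  then show ?thesis
    using unit_tangent_cross[OF assms] by (simp add: rotation_def arc_point_def sgn_div_norm)
qed

text \<open>The spherical trigonometry of one refinement step. The first arc of length \<open>e\<close> leaves \<open>p\<close>
  at the angle \<open>\<alpha>\<close> against \<open>w\<close> and ends in the apex \<open>r\<close>; turning there by \<open>-\<phi>\<close> and walking \<open>e\<close>
  again leads to the other end of the base, where the direction deviates by \<open>-\<alpha>\<close> from that of
  the base. For \<open>\<alpha> > 0\<close> the altitude cuts the triangle into two right-angled ones with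
  hypotenuse \<open>e\<close>, leg \<open>l / 2\<close>, angle \<open>\<alpha>\<close> at the base and angle \<open>(pi - \<phi>) / 2\<close> at the apex. Napier's rules for these
  give \<open>tan e = tan (l / 2) / cos \<alpha>\<close> and \<open>tan (\<phi> / 2) = cos e * tan \<alpha>\<close>; the second identity is
  the key to the whole proof, since it says by how much the defect \<open>\<phi>\<close> at a new vertex falls
  short of the planar value \<open>2 * \<alpha>\<close>. The verification compares the components in the orthonormal
  basis \<open>p\<close>, \<open>w\<close>, \<open>p \<times> w\<close>.\<close>

lemma isosceles_apex:
  assumes fr: "unit_tangent p w"
    and l: "0 < l" "l < pi" and a: "\<bar>\<alpha>\<bar> < pi / 2"
    and e: "e = arctan (tan (l / 2) / cos \<alpha>)"
    and phi: "\<phi> = 2 * arctan (cos e * tan \<alpha>)"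
    and r: "r = arc_point p (turn p \<alpha> w) e"
    and X: "X = turn r (- \<phi>) (arc_tangent p (turn p \<alpha> w) e)"
  shows "arc_point r X e = arc_point p w l" "arc_tangent r X e = turn (arc_point p w l) (- \<alpha>) (arc_tangent p w l)"
proof -
  define n where "n = p \<times> w"
  \<comment> \<open>Both \<open>cos (l / 2)\<close> and \<open>cos (\<phi> / 2)\<close> lead to the same denominator \<open>D\<close>, so that all components
    become rational functions of \<open>c\<close>, \<open>s\<close>, \<open>b\<close>, \<open>d\<close>.\<close>
  define c s b d D where "c = cos e" "s = sin e" "b = cos \<alpha>" "d = sin \<alpha>" "D = b\<^sup>2 + c\<^sup>2 * d\<^sup>2"
  note defs = this
  have b: "b > 0" using a by (auto simp: defs cos_gt_zero_pi)
  have "c > 0" unfolding defs e by (simp add: cos_arctan add_pos_nonneg)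
  have cs: "s\<^sup>2 = 1 - c\<^sup>2" "d\<^sup>2 = 1 - b\<^sup>2" by (simp_all add: defs sin_squared_eq)
  have D: "D > 0" using b by (auto simp: defs(5) add_pos_nonneg)
  have D2: "D = c\<^sup>2 + s\<^sup>2 * b\<^sup>2" using cs unfolding defs(5) by algebra
  have te: "tan (l / 2) = s * b / c"
  proof -
    have "tan e = tan (l/2) / b" unfolding e defs by (simp add: tan_arctan)
    then have "tan (l / 2) = b * tan e" using b by (simp add: field_simps)
    then show ?thesis by (simp add: tan_def defs)
  qed
  have cl2: "cos (l/2) > 0" using l by (intro cos_gt_zero_pi) auto
  have C: "cos (l/2) ^ 2 = c\<^sup>2 / D"
  proof -
    have "1 / cos (l/2) ^ 2 = 1 + tan (l/2) ^ 2"
      using cl2 by (simp add: tan_sec power_divide inverse_eq_divide)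
    also have "\<dots> = D / c\<^sup>2" unfolding te D2 using \<open>c > 0\<close> by (simp add: field_simps)
    finally show ?thesis using cl2 D \<open>c > 0\<close> by (simp add: field_simps)
  qed
  have cosl: "cos l = (c\<^sup>2 - s\<^sup>2 * b\<^sup>2) / D"
    using cos_double_cos[of "l/2"] C D D2 by (simp add: field_simps)
  have sinl: "sin l = 2 * s * c * b / D"
  proof -
    have "sin l = 2 * tan (l/2) * cos (l/2) ^ 2"
      using sin_double[of "l/2"] cl2 by (simp add: tan_def power2_eq_square)
    then show ?thesis unfolding te C using \<open>c > 0\<close> by (simp add: field_simps power2_eq_square)
  qed
  define h where "h = arctan (cos e * tan \<alpha>)"
  have th: "tan h = c * d / b" unfolding h_def tan_arctan by (simp add: defs tan_def)
  have ch: "cos h > 0" unfolding h_def by (simp add: cos_arctan add_pos_nonneg)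
  have Ch: "cos h ^ 2 = b\<^sup>2 / D"
  proof -
    have "1 / cos h ^ 2 = 1 + tan h ^ 2"
      using ch by (simp add: tan_sec power_divide inverse_eq_divide)
    also have "\<dots> = D / b\<^sup>2" unfolding th defs(5) using \<open>b > 0\<close> by (simp add: field_simps)
    finally show ?thesis using ch D \<open>b > 0\<close> by (simp add: field_simps)
  qed
  have phi_h: "\<phi> = 2 * h" by (simp add: phi h_def)
  have cosp: "cos \<phi> = (b\<^sup>2 - c\<^sup>2 * d\<^sup>2) / D"
    unfolding phi_h cos_double_cos Ch using D by (simp add: field_simps defs(5))
  have sinp: "sin \<phi> = 2 * b * c * d / D"
  proof -
    have "sin \<phi> = 2 * tan h * cos h ^ 2"
      using sin_double[of h] ch by (simp add: tan_def power2_eq_square phi_h)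
    then show ?thesis unfolding th Ch using \<open>b > 0\<close> by (simp add: field_simps power2_eq_square)
  qed
  let ?w = "turn p \<alpha> w"
  have w': "?w = b *\<^sub>R w + d *\<^sub>R n" by (simp add: turn_def n_def defs)
  have cr: "r \<times> arc_tangent p ?w e = b *\<^sub>R n - d *\<^sub>R w"
    unfolding r cross_arc[OF unit_tangent_turn[OF fr]]
    by (simp add: w' cross_add_right cross_mult_right n_def unit_tangent_cross[OF fr])
  have X': "X = cos \<phi> *\<^sub>R (c *\<^sub>R ?w - s *\<^sub>R p) - sin \<phi> *\<^sub>R (b *\<^sub>R n - d *\<^sub>R w)"
    unfolding X by (subst turn_def) (simp add: cr, simp add: arc_tangent_def defs)
  have r': "r = c *\<^sub>R p + s *\<^sub>R ?w" by (simp add: r arc_point_def defs)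
  have k: "c * c - s * s * cos \<phi> = cos l"
          "c * s * b + s * (cos \<phi> * c * b + sin \<phi> * d) = sin l"
          "c * s * d + s * (cos \<phi> * c * d - sin \<phi> * b) = 0"
    using D unfolding cosl sinl cosp sinp
    by (simp_all add: field_simps) (use cs D2 defs(5) in algebra)+
  have "arc_point r X e = (c * c - s * s * cos \<phi>) *\<^sub>R p + (c * s * b + s * (cos \<phi> * c * b + sin \<phi> * d)) *\<^sub>R w
      + (c * s * d + s * (cos \<phi> * c * d - sin \<phi> * b)) *\<^sub>R n"
    by (subst arc_point_def) (simp add: X' r' w' defs(1,2)[symmetric] algebra_simps)
  then show "arc_point r X e = arc_point p w l" unfolding k by (simp add: arc_point_def)
  have k': "- (c * s * cos \<phi> + s * c) = - (b * sin l)"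
          "c * (cos \<phi> * c * b + sin \<phi> * d) - s * s * b = b * cos l"
          "c * (cos \<phi> * c * d - sin \<phi> * b) - s * s * d = - d"
    using D unfolding cosl sinl cosp sinp
    by (simp_all add: field_simps) (use cs D2 defs(5) in algebra)+
  have "arc_tangent r X e = (- (c * s * cos \<phi> + s * c)) *\<^sub>R p + (c * (cos \<phi> * c * b + sin \<phi> * d) - s * s * b) *\<^sub>R w
      + (c * (cos \<phi> * c * d - sin \<phi> * b) - s * s * d) *\<^sub>R n"
    by (subst arc_tangent_def) (simp add: X' r' w' defs(1,2)[symmetric] algebra_simps)
  then show "arc_tangent r X e = turn (arc_point p w l) (- \<alpha>) (arc_tangent p w l)" unfolding k'
    by (subst turn_def) (simp add: cross_arc[OF fr], simp add: arc_tangent_def n_def defs algebra_simps)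
qed

lemma cos_ge_parabola: "1 - x\<^sup>2 / 2 \<le> cos (x :: real)"
proof -
  have "(sin (x/2))\<^sup>2 \<le> (x/2)\<^sup>2"
    using abs_sin_x_le_abs_x[of "x/2"] by (metis abs_le_square_iff)
  then show ?thesis using cos_double_sin[of "x/2"] by (simp add: power_divide)
qed

lemma norm_arc_point_diff: assumes "unit_tangent p w" shows "norm (arc_point p w t - p) \<le> \<bar>t\<bar>"
proof -
  have "(norm (arc_point p w t - p))\<^sup>2 = 2 - 2 * cos t"
    using unit_tangentD[OF assms]
    by (simp add: power2_norm_eq_inner arc_point_def inner_add inner_diff) (use sin_cos_squared_add[of t] in algebra)
  also have "\<dots> \<le> \<bar>t\<bar>\<^sup>2" using cos_ge_parabola[of t] by simp
  finally show ?thesis by (rule power2_le_imp_le) simp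
qed

lemma norm_arc_tangent_diff: assumes "unit_tangent p w" shows "norm (arc_tangent p w t - w) \<le> \<bar>t\<bar>"
proof -
  have "unit_tangent w (- p)" using assms by (auto simp: unit_tangent_def inner_commute)
  from norm_arc_point_diff[OF this, of t] show ?thesis by (simp add: arc_point_def arc_tangent_def)
qed

lemma norm_turn_diff: assumes "unit_tangent p w" shows "norm (turn p \<theta> w - w) \<le> \<bar>\<theta>\<bar>"
proof -
  have "unit_tangent w (p \<times> w)" using assms unit_tangent_cross[OF assms] by (auto simp: unit_tangent_def norm_eq_1)
  from norm_arc_point_diff[OF this, of \<theta>] show ?thesis by (simp add: arc_point_def turn_def)
qed

lemma arc_point_distinct: assumes "unit_tangent p w" "0 < l" "l < pi" shows "arc_point p w l \<noteq> p" "p \<noteq> - arc_point p w l"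
proof -
  have "sin l \<noteq> 0" using sin_gt_zero[of l] assms by simp
  moreover have "arc_point p w l \<bullet> w = sin l" using unit_tangentD[OF assms(1)] by (simp add: arc_point_def inner_add)
  ultimately show "arc_point p w l \<noteq> p" "p \<noteq> - arc_point p w l"
    using unit_tangentD(3)[OF assms(1)] by (metis, metis inner_minus_left neg_equal_0_iff_equal)
qed

lemma sgn_chord:
  assumes "unit_tangent p w" "0 < l" "l < pi"
  shows "norm (sgn (arc_point p w l - p) - w) \<le> l"
proof -
  have s: "sin (l/2) > 0" using assms by (intro sin_gt_zero) auto
  have "arc_point p w l - p = (2 * sin (l/2)) *\<^sub>R arc_tangent p w (l/2)"
  proof -
    have c: "cos l = 1 - 2 * (sin (l/2))\<^sup>2" and s: "sin l = 2 * sin (l/2) * cos (l/2)"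
      using cos_double_sin[of "l/2"] sin_double[of "l/2"] by simp_all
    show ?thesis unfolding arc_point_def c s by (simp add: arc_tangent_def algebra_simps power2_eq_square)
  qed
  moreover have "norm (arc_tangent p w (l/2)) = 1"
    using unit_tangent_arc[OF assms(1)] by (simp add: unit_tangent_def)
  ultimately have "sgn (arc_point p w l - p) = arc_tangent p w (l/2)"
    using s by (simp add: sgn_div_norm)
  then show ?thesis using norm_arc_tangent_diff[OF assms(1), of "l/2"] assms by simp
qed

section \<open>One refinement step\<close>

text \<open>A polygon described by its traveller: \<open>W i\<close> is the direction in which vertex \<open>i\<close> is left,
  \<open>l i\<close> the length of the following edge, and turning from \<open>W i\<close> by \<open>\<delta> i\<close> gives the direction of
  arrival, in agreement with the sign convention for the angular defect. The bound \<open>pi / 2\<close>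
  keeps \<open>tan (l i)\<close> positive and finite.\<close>

definition framed_polygon ::
  "(int \<Rightarrow> real^3) \<Rightarrow> (int \<Rightarrow> real^3) \<Rightarrow> (int \<Rightarrow> real) \<Rightarrow> (int \<Rightarrow> real) \<Rightarrow> bool" where
  "framed_polygon P W l \<delta> \<longleftrightarrow>
     (\<forall>i. unit_tangent (P i) (W i) \<and> 0 < l i \<and> l i < pi / 2 \<and> \<bar>\<delta> i\<bar> < pi \<and>
          P (i + 1) = arc_point (P i) (W i) (l i) \<and>
          arc_tangent (P i) (W i) (l i) = turn (P (i + 1)) (\<delta> (i + 1)) (W (i + 1)))"

lemma framed_polygonD:
  assumes "framed_polygon P W l \<delta>"
  shows "unit_tangent (P i) (W i)" "0 < l i" "l i < pi / 2" "\<bar>\<delta> i\<bar> < pi"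
    "P (i + 1) = arc_point (P i) (W i) (l i)"
    "arc_tangent (P i) (W i) (l i) = turn (P (i + 1)) (\<delta> (i + 1)) (W (i + 1))"
  using assms unfolding framed_polygon_def by blast+

lemma framed_polygon_data:
  assumes fp: "framed_polygon P W l \<delta>"
  shows "geo_dist (P i) (P (i + 1)) = l i" "start_tangent (P i) (P (i + 1)) = W i"
    "end_tangent (P (i - 1)) (P i) = turn (P i) (\<delta> i) (W i)" "angular_defect P i = \<delta> i"
proof -
  note D = framed_polygonD[OF fp]
  have l: "l i < pi" for i using D(3)[of i] pi_gt_zero by linarith
  show "geo_dist (P i) (P (i + 1)) = l i"
    unfolding D(5) by (rule geo_dist_arc_point[OF D(1,2) l])
  show st: "start_tangent (P i) (P (i + 1)) = W i"
    unfolding D(5) by (rule start_tangent_arc_point[OF D(1,2) l])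
  show et: "end_tangent (P (i - 1)) (P i) = turn (P i) (\<delta> i) (W i)"
    using end_tangent_arc_point[OF D(1,2) l, of "i - 1" ] D(5)[of "i - 1"] D(6)[of "i - 1"] by simp
  show "angular_defect P i = \<delta> i"
    unfolding angular_defect_def st et
    by (rule signed_angle_turn_right[OF D(1)]) (use D(4)[of i] in linarith)+
qed

text \<open>Lengths and defects of the refined polygon depend on lengths and defects of the given one
  only. The following functions are this recursion, the geometry being removed.\<close>

definition base_angle :: "(int \<Rightarrow> real) \<Rightarrow> int \<Rightarrow> real" where
  "base_angle \<delta> i = (\<delta> i + \<delta> (i + 1)) / 8"

definition leg :: "(int \<Rightarrow> real) \<Rightarrow> (int \<Rightarrow> real) \<Rightarrow> int \<Rightarrow> real" where
  "leg l \<delta> i = arctan (tan (l i / 2) / cos (base_angle \<delta> i))"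

definition apex_defect :: "(int \<Rightarrow> real) \<Rightarrow> (int \<Rightarrow> real) \<Rightarrow> int \<Rightarrow> real" where
  "apex_defect l \<delta> i = 2 * arctan (cos (leg l \<delta> i) * tan (base_angle \<delta> i))"

definition refined_length :: "(int \<Rightarrow> real) \<Rightarrow> (int \<Rightarrow> real) \<Rightarrow> int \<Rightarrow> real" where
  "refined_length l \<delta> k = leg l \<delta> (k div 2)"

definition refined_defect :: "(int \<Rightarrow> real) \<Rightarrow> (int \<Rightarrow> real) \<Rightarrow> int \<Rightarrow> real" where
  "refined_defect l \<delta> k =
     (if even k then \<delta> (k div 2) - base_angle \<delta> (k div 2) - base_angle \<delta> (k div 2 - 1)
      else apex_defect l \<delta> (k div 2))"

lemma refined_defect_even:
  "refined_defect l \<delta> (2 * i) = (6 * \<delta> i - \<delta> (i - 1) - \<delta> (i + 1)) / 8"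
  by (simp add: refined_defect_def base_angle_def field_simps)

lemma refined_defect_odd: "refined_defect l \<delta> (2 * i + 1) = apex_defect l \<delta> i"
  by (simp add: refined_defect_def)

text \<open>At an old vertex the two adjacent isosceles triangles cut off their base angles from the
  defect, and at a new vertex the apex formula applies. The bound on the defects keeps the base
  angles away from \<open>pi / 2\<close> and every angle that occurs inside the interval \<open>]-pi, pi[\<close>, where
  signed angles add up without a correction by multiples of \<open>2 * pi\<close>.\<close>

lemma framed_polygon_sbigs_step:
  assumes fp: "framed_polygon P W l \<delta>" and small: "\<And>i. \<bar>\<delta> i\<bar> \<le> 1"
  obtains W' where
    "framed_polygon (sbigs_step P) W' (refined_length l \<delta>) (refined_defect l \<delta>)"
    "\<And>i. W' (2 * i) = turn (P i) (base_angle \<delta> i) (W i)"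
proof -
  note D = framed_polygonD[OF fp]
  define \<alpha> where "\<alpha> = base_angle \<delta>"
  define e where "e = leg l \<delta>"
  define \<phi> where "\<phi> = apex_defect l \<delta>"
  define r where "r i = arc_point (P i) (turn (P i) (\<alpha> i) (W i)) (e i)" for i
  define Y where "Y i = arc_tangent (P i) (turn (P i) (\<alpha> i) (W i)) (e i)" for i
  define X where "X i = turn (r i) (- \<phi> i) (Y i)" for i
  define W' where "W' k = (if even k then turn (P (k div 2)) (\<alpha> (k div 2)) (W (k div 2)) else X (k div 2))" for k
  have \<alpha>: "\<bar>\<alpha> i\<bar> \<le> 1/4" for i
    using small[of i] small[of "i+1"] unfolding \<alpha>_def base_angle_def by (simp add: abs_le_iff)
  have \<alpha>2: "\<bar>\<alpha> i\<bar> < pi / 2" for i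
    using \<alpha>[of i] pi_gt3 by linarith
  have e: "0 < e i \<and> e i < pi / 2" for i
  proof -
    have "cos (\<alpha> i) > 0" using \<alpha>2[of i] by (intro cos_gt_zero_pi) linarith+
    moreover have "tan (l i / 2) > 0" using D(2,3)[of i] by (intro tan_gt_zero) linarith+
    ultimately show ?thesis unfolding e_def leg_def \<alpha>_def[symmetric]
      using arctan_ubound by simp
  qed
  have \<phi>: "\<bar>\<phi> i\<bar> < pi" for i
    unfolding \<phi>_def apex_defect_def
    using arctan_bounded[of "cos (leg l \<delta> i) * tan (base_angle \<delta> i)"] by linarith
  have l: "l i < pi" for i using D(3)[of i] pi_gt_zero by linarith
  have point: "sbigs_point P i = r i" for i
  proof -
    have "sbigs_angle P i = \<alpha> i"
      by (simp add: sbigs_angle_def framed_polygon_data[OF fp] \<alpha>_def base_angle_def)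
    moreover from this have "sbigs_edge P i = e i"
      by (simp add: sbigs_edge_def framed_polygon_data[OF fp] e_def leg_def \<alpha>_def)
    ultimately show ?thesis
      by (simp add: sbigs_point_def framed_polygon_data[OF fp] Let_def rotation_turn[OF D(1)]
          rotation_arc_point[OF unit_tangent_turn[OF D(1)]] r_def)
  qed
  have even: "sbigs_step P (2 * i) = P i" and odd: "sbigs_step P (2 * i + 1) = r i" for i
    by (simp_all add: sbigs_step_def point)
  have frY: "unit_tangent (r i) (Y i)" for i
    unfolding r_def Y_def by (intro unit_tangent_arc unit_tangent_turn D(1))
  have frX: "unit_tangent (r i) (X i)" for i
    unfolding X_def by (intro unit_tangent_turn frY)
  have apex: "arc_point (r i) (X i) (e i) = P (i + 1)"
    "arc_tangent (r i) (X i) (e i) = turn (P (i + 1)) (- \<alpha> i) (arc_tangent (P i) (W i) (l i))" for i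
    unfolding D(5)
    by (rule isosceles_apex[where e = "e i" and \<phi> = "\<phi> i" and r = "r i" and X = "X i", OF D(1,2) l \<alpha>2];
        simp add: e_def leg_def \<alpha>_def \<phi>_def apex_defect_def r_def X_def Y_def)+
  have main: "unit_tangent (sbigs_step P k) (W' k) \<and> 0 < refined_length l \<delta> k \<and> refined_length l \<delta> k < pi / 2 \<and>
      \<bar>refined_defect l \<delta> k\<bar> < pi \<and>
      sbigs_step P (k + 1) = arc_point (sbigs_step P k) (W' k) (refined_length l \<delta> k) \<and>
      arc_tangent (sbigs_step P k) (W' k) (refined_length l \<delta> k) =
        turn (sbigs_step P (k + 1)) (refined_defect l \<delta> (k + 1)) (W' (k + 1))" for k
  proof (cases "even k")
    case True
    then obtain i where k: "k = 2 * i" by blast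
    have "\<bar>refined_defect l \<delta> k\<bar> < pi"
      using small[of i] small[of "i + 1"] small[of "i - 1"] pi_gt3
      unfolding k refined_defect_even by (simp add: abs_less_iff) linarith
    moreover have "Y i = turn (r i) (\<phi> i) (X i)"
      unfolding X_def turn_turn[OF frY] by (simp add: turn_def)
    ultimately show ?thesis
      using e[of i] unfolding k even odd refined_defect_odd \<phi>_def[symmetric]
      by (simp add: refined_length_def W'_def e_def[symmetric] unit_tangent_turn D(1) r_def Y_def)
  next
    case False
    then obtain i where k: "k = 2 * i + 1" by (elim oddE)
    have k1: "k + 1 = 2 * (i + 1)" by (simp add: k)
    have dk: "refined_defect l \<delta> (2 * (i + 1)) + \<alpha> (i + 1) = - \<alpha> i + \<delta> (i + 1)"
      unfolding refined_defect_even by (simp add: \<alpha>_def base_angle_def field_simps)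
    have "arc_tangent (r i) (X i) (e i) =
        turn (P (i + 1)) (refined_defect l \<delta> (2 * (i + 1))) (turn (P (i + 1)) (\<alpha> (i + 1)) (W (i + 1)))"
      unfolding apex D(6) turn_turn[OF D(1)] dk ..
    then show ?thesis
      using e[of i] frX[of i] \<phi>[of i] apex(1)[of i]
      unfolding k1 even unfolding k odd refined_defect_odd \<phi>_def[symmetric]
      by (simp add: refined_length_def W'_def e_def[symmetric])
  qed
  show ?thesis
  proof (rule that)
    show "framed_polygon (sbigs_step P) W' (refined_length l \<delta>) (refined_defect l \<delta>)"
      unfolding framed_polygon_def using main by blast
    show "W' (2 * i) = turn (P i) (base_angle \<delta> i) (W i)" for i
      by (simp add: W'_def \<alpha>_def)
  qed
qed

section \<open>Decay of defects and edge lengths\<close>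

text \<open>A consequence of the concavity of \<open>arctan\<close> on the positive half-line.\<close>

lemma arctan_mult_ge:
  assumes "0 \<le> c" "c \<le> 1" "0 \<le> t"
  shows "c * arctan t \<le> arctan (c * t)"
proof -
  have "arctan (c * 0) - c * arctan 0 \<le> arctan (c * t) - c * arctan t"
  proof (rule DERIV_nonneg_imp_nondecreasing[OF \<open>0 \<le> t\<close>])
    fix x :: real
    have "c / (1 + x\<^sup>2) \<le> c / (1 + (c * x)\<^sup>2)"
      using assms by (intro divide_left_mono) (auto simp: power_mult_distrib power_le_one mult_left_le_one_le add_pos_nonneg)
    then show "\<exists>y. ((\<lambda>x. arctan (c * x) - c * arctan x) has_real_derivative y) (at x) \<and> 0 \<le> y"
      by (intro exI[of _ "c / (1 + (c * x)\<^sup>2) - c / (1 + x\<^sup>2)"])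
         (auto intro!: derivative_eq_intros simp: divide_inverse)
  qed
  then show ?thesis by simp
qed

text \<open>With the cosine of the leg for \<open>c\<close>, these bounds compare the apex defect with its planar
  value. The size of the error matters for decay, its sign for the growth of curvature.\<close>

lemma arctan_mult_tan_bounds:
  assumes c: "0 \<le> c" "c \<le> 1" and a: "0 \<le> a" "a < pi / 2"
  shows "c * a \<le> arctan (c * tan a)" "arctan (c * tan a) \<le> a"
proof -
  have t: "0 \<le> tan a" "arctan (tan a) = a"
    using a by (auto intro: tan_pos_pi2_le arctan_tan)
  show "c * a \<le> arctan (c * tan a)" using arctan_mult_ge[OF c t(1)] t by simp
  have "arctan (c * tan a) \<le> arctan (tan a)"
    using t c by (intro arctan_monotone') (simp add: mult_left_le_one_le)
  then show "arctan (c * tan a) \<le> a" using t by simp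
qed

lemma arctan_mult_tan_abs:
  assumes c: "0 \<le> c" "c \<le> 1" and a: "\<bar>a\<bar> < pi / 2"
  shows "\<bar>arctan (c * tan a)\<bar> \<le> \<bar>a\<bar>" "\<bar>arctan (c * tan a) - a\<bar> \<le> (1 - c) * \<bar>a\<bar>"
proof -
  note B = arctan_mult_tan_bounds[OF c, of "\<bar>a\<bar>"]
  have ca: "0 \<le> c * \<bar>a\<bar>" using c by simp
  have "\<bar>arctan (c * tan a)\<bar> \<le> \<bar>a\<bar> \<and> \<bar>arctan (c * tan a) - a\<bar> \<le> (1 - c) * \<bar>a\<bar>"
  proof (cases "a \<ge> 0")
    case True
    then show ?thesis using B a ca by (simp add: algebra_simps abs_le_iff)
  next
    case False
    then show ?thesis using B a ca by (simp add: algebra_simps abs_le_iff arctan_minus)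
  qed
  then show "\<bar>arctan (c * tan a)\<bar> \<le> \<bar>a\<bar>" "\<bar>arctan (c * tan a) - a\<bar> \<le> (1 - c) * \<bar>a\<bar>" by auto
qed

text \<open>Halving an edge divides its tangent by at least 2, with no error term to sum up; this is
  why edges are measured by the tangents of their lengths below.\<close>

lemma tan_half_le:
  assumes "0 \<le> x" "x < pi / 2"
  shows "tan (x / 2) \<le> tan x / 2"
proof -
  define t where "t = tan (x / 2)"
  have t: "0 \<le> t" "t < 1"
    using assms tan_pos_pi2_le[of "x/2"] tan_monotone[of "x/2" "pi/4"] by (auto simp: t_def tan_45)
  have "cos (x/2) > 0" "cos x > 0" using assms by (auto intro!: cos_gt_zero_pi)
  then have "tan x = 2 * t / (1 - t\<^sup>2)" using tan_double[of "x/2"] by (simp add: t_def)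
  moreover have "2 * t \<le> 2 * t / (1 - t\<^sup>2)"
    using t by (simp add: le_divide_eq power_less_one_iff mult_left_le algebra_simps abs_square_less_1)
  ultimately have "2 * t \<le> tan x" by (simp only:)
  then show ?thesis by (simp add: t_def)
qed

text \<open>The invariant of the refinement. Bounding defects alone does not work, because the mask
  \<open>(-1, 6, -1) / 8\<close> at old vertices has norm 1. Its value can however be written as \<open>\<delta> i / 2 +
  (\<delta> i - \<delta> (i - 1)) / 8 + (\<delta> i - \<delta> (i + 1)) / 8\<close>, so that a common bound for defects and their
  differences shrinks by the factor \<open>1/2 + 2/8 = 3/4\<close>. The differences themselves are halved by
  the planar scheme, which leaves a quarter for its spherical perturbation. The numerator
  \<open>2 - (3/4) ^ j\<close> leaves room for the factors \<open>1 / cos\<close> of the base angles, whose product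
  converges, and shows that edge lengths are \<open>O(1 / 2 ^ j)\<close>.\<close>

definition controlled :: "nat \<Rightarrow> (int \<Rightarrow> real) \<Rightarrow> (int \<Rightarrow> real) \<Rightarrow> bool" where
  "controlled j l \<delta> \<longleftrightarrow>
     (\<forall>i. \<bar>\<delta> i\<bar> \<le> (3/4) ^ j \<and> \<bar>\<delta> (i + 1) - \<delta> i\<bar> \<le> (3/4) ^ j \<and>
          0 < l i \<and> l i < pi / 2 \<and> tan (l i) \<le> (2 - (3/4) ^ j) / 2 ^ j)"

lemma controlled_refine:
  assumes "controlled j l \<delta>"
  shows "controlled (Suc j) (refined_length l \<delta>) (refined_defect l \<delta>)"
proof -
  define y :: real where "y = (3/4) ^ j"
  have y: "0 < y" "y \<le> 1" by (auto simp: y_def power_le_one)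
  have C: "\<bar>\<delta> i\<bar> \<le> y" "\<bar>\<delta> (i + 1) - \<delta> i\<bar> \<le> y" "0 < l i" "l i < pi / 2" "tan (l i) \<le> (2 - y) / 2 ^ j" for i
    using assms unfolding controlled_def y_def by blast+
  have a: "\<bar>base_angle \<delta> i\<bar> \<le> y / 4" for i
    using C(1)[of i] C(1)[of "i + 1"] unfolding base_angle_def by (simp add: abs_le_iff)
  have apos: "\<bar>base_angle \<delta> i\<bar> < pi / 2" for i using a[of i] y pi_gt3 by linarith
  have cosb: "cos (base_angle \<delta> i) \<ge> 1 - y\<^sup>2 / 32" for i
  proof -
    have "(base_angle \<delta> i)\<^sup>2 \<le> (y / 4)\<^sup>2" using a[of i] y by (intro abs_le_square_iff[THEN iffD1]) simp
    then show ?thesis using cos_ge_parabola[of "base_angle \<delta> i"] by (simp add: power_divide)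
  qed
  have y2: "y\<^sup>2 \<le> y" using y by (simp add: power2_eq_square mult_left_le_one_le)
  have tan_leg: "0 < tan (leg l \<delta> i)" "tan (leg l \<delta> i) \<le> (2 - 3 * y / 4) / 2 ^ Suc j" for i
  proof -
    have cp: "cos (base_angle \<delta> i) > 0" using cosb[of i] y y2 by linarith
    have t: "tan (leg l \<delta> i) = tan (l i / 2) / cos (base_angle \<delta> i)"
      by (simp add: leg_def tan_arctan)
    have "tan (l i / 2) > 0" using C(3,4)[of i] by (intro tan_gt_zero) auto
    then show "0 < tan (leg l \<delta> i)" using cp t by simp
    have "tan (l i / 2) \<le> (2 - y) / 2 ^ Suc j"
      using tan_half_le[of "l i"] C(3-5)[of i] by simp
    also have "\<dots> \<le> ((2 - 3 * y / 4) * (1 - y\<^sup>2 / 32)) / 2 ^ Suc j"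
    proof (rule divide_right_mono)
      have "(2 - 3 * y / 4) * (1 - y\<^sup>2 / 32) - (2 - y) = (y / 4 - y\<^sup>2 / 16) + 3 * y * y\<^sup>2 / 128"
        by (simp add: algebra_simps)
      also have "\<dots> \<ge> 0" using y y2 by (intro add_nonneg_nonneg) auto
      finally show "2 - y \<le> (2 - 3 * y / 4) * (1 - y\<^sup>2 / 32)" by simp
    qed simp
    also have "\<dots> \<le> ((2 - 3 * y / 4) * cos (base_angle \<delta> i)) / 2 ^ Suc j"
      using y cosb[of i] by (intro divide_right_mono mult_left_mono) auto
    finally show "tan (leg l \<delta> i) \<le> (2 - 3 * y / 4) / 2 ^ Suc j"
      unfolding t using cp by (simp add: divide_le_eq mult.commute)
  qed
  have leg: "0 < leg l \<delta> i" "leg l \<delta> i < pi / 2" for i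
    using tan_leg(1)[of i] arctan_ubound by (auto simp: leg_def tan_arctan)
  \<comment> \<open>A loss of at most half of the planar apex defect is exactly what the factor \<open>3/4\<close> for the
    differences tolerates.\<close>
  have cosl: "1/2 \<le> cos (leg l \<delta> i)" for i
  proof -
    have "tan (leg l \<delta> i) \<le> 2 / 2 ^ Suc j"
      using y by (intro order_trans[OF tan_leg(2)] divide_right_mono) auto
    also have "\<dots> \<le> 1" by simp
    finally have t1: "tan (leg l \<delta> i) \<le> tan (pi / 4)" by (simp add: tan_45)
    have "leg l \<delta> i \<le> pi / 4"
      using t1 leg[of i] by (subst (asm) tan_mono_le_eq) auto
    then have "cos (pi / 3) \<le> cos (leg l \<delta> i)"
      using leg[of i] by (intro cos_monotone_0_pi_le) auto
    then show ?thesis by (simp add: cos_60)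
  qed
  have phi: "\<bar>apex_defect l \<delta> i\<bar> \<le> y / 2" "\<bar>apex_defect l \<delta> i - 2 * base_angle \<delta> i\<bar> \<le> y / 4" for i
  proof -
    note B = arctan_mult_tan_abs[of "cos (leg l \<delta> i)" "base_angle \<delta> i"]
    have "(1 - cos (leg l \<delta> i)) * \<bar>base_angle \<delta> i\<bar> \<le> (1/2) * (y / 4)"
      using cosl[of i] a[of i] y by (intro mult_mono) auto
    then show "\<bar>apex_defect l \<delta> i\<bar> \<le> y / 2" "\<bar>apex_defect l \<delta> i - 2 * base_angle \<delta> i\<bar> \<le> y / 4"
      using B apos[of i] a[of i] cosl[of i] cos_le_one[of "leg l \<delta> i"] unfolding apex_defect_def
      by linarith+
  qed
  have bounds: "\<delta> i \<le> y" "- \<delta> i \<le> y" "\<delta> (i + 1) - \<delta> i \<le> y" "\<delta> i - \<delta> (i + 1) \<le> y"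
      "apex_defect l \<delta> i \<le> y / 2" "- apex_defect l \<delta> i \<le> y / 2"
      "apex_defect l \<delta> i - (\<delta> i + \<delta> (i + 1)) / 4 \<le> y / 4"
      "(\<delta> i + \<delta> (i + 1)) / 4 - apex_defect l \<delta> i \<le> y / 4" for i
  proof -
    have "2 * base_angle \<delta> i = (\<delta> i + \<delta> (i + 1)) / 4" by (simp add: base_angle_def)
    note P = phi[of i, unfolded this]
    show "\<delta> i \<le> y" "- \<delta> i \<le> y" "\<delta> (i + 1) - \<delta> i \<le> y" "\<delta> i - \<delta> (i + 1) \<le> y"
      using C(1,2)[of i] by linarith+
    show "apex_defect l \<delta> i \<le> y / 2" "- apex_defect l \<delta> i \<le> y / 2"
      "apex_defect l \<delta> i - (\<delta> i + \<delta> (i + 1)) / 4 \<le> y / 4"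
      "(\<delta> i + \<delta> (i + 1)) / 4 - apex_defect l \<delta> i \<le> y / 4"
      using P[THEN abs_le_D1] P[THEN abs_le_D2] by linarith+
  qed
  have prev: "\<delta> i - \<delta> (i - 1) \<le> y" "\<delta> (i - 1) - \<delta> i \<le> y" for i
    using bounds(3,4)[of "i - 1"] by simp_all
  have "\<bar>refined_defect l \<delta> k\<bar> \<le> 3 / 4 * y \<and> \<bar>refined_defect l \<delta> (k + 1) - refined_defect l \<delta> k\<bar> \<le> 3 / 4 * y" for k
  proof (cases "even k")
    case True
    then obtain i where k: "k = 2 * i" by blast
    show ?thesis
      using bounds[of i] prev[of i]
      unfolding k refined_defect_even refined_defect_odd add_divide_distrib diff_divide_distrib by (intro conjI abs_leI; linarith)
  next
    case False
    then obtain i where k: "k = 2 * i + 1" by (elim oddE)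
    have k1: "k + 1 = 2 * (i + 1)" by (simp add: k)
    have shift: "\<delta> (i + 1 - 1) = \<delta> i" by simp
    show ?thesis
      using bounds[of i] bounds(3,4)[of "i + 1"] shift prev[of "i + 1"] y
      unfolding k1 refined_defect_even unfolding k refined_defect_odd
        add_divide_distrib diff_divide_distrib by (intro conjI abs_leI; linarith)
  qed
  moreover have "refined_length l \<delta> k > 0 \<and> refined_length l \<delta> k < pi / 2 \<and>
      tan (refined_length l \<delta> k) \<le> (2 - 3 / 4 * y) / 2 ^ Suc j" for k
    using leg tan_leg unfolding refined_length_def by simp
  ultimately show ?thesis unfolding controlled_def by (simp add: y_def)
qed

section \<open>Limits of dyadic data and secants of the limit curve\<close>

text \<open>Data attached to the dyadic intervals of level \<open>j\<close> form a step function of the parameter.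
  If passing to the two halves of an interval, and passing to the next interval, both change the
  data by a geometrically small amount, the step functions converge uniformly, and the limit is
  continuous since the jumps tend to zero. This is used for the vertices and once more for the
  edge directions.\<close>

lemma dyadic_limit:
  fixes x :: "nat \<Rightarrow> int \<Rightarrow> 'a :: banach"
  assumes q: "0 \<le> q" "q < 1"
    and even: "\<And>j i. norm (x (Suc j) (2 * i) - x j i) \<le> C * q ^ j"
    and odd: "\<And>j i. norm (x (Suc j) (2 * i + 1) - x j i) \<le> C * q ^ j"
    and step: "\<And>j i. norm (x j (i + 1) - x j i) \<le> C * q ^ j"
  obtains c where "continuous_on UNIV c"
    "\<And>j (t :: real). norm (c t - x j \<lfloor>2 ^ j * t\<rfloor>) \<le> C / (1 - q) * q ^ j"
proof -
  define s where "s j t = x j \<lfloor>2 ^ j * t\<rfloor>" for j and t :: real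
  define f where "f t j = s (Suc j) t - s j t" for j t
  define c where "c t = s 0 t + suminf (f t)" for t
  have f: "norm (f t j) \<le> C * q ^ j" for t j
  proof -
    define i where "i = \<lfloor>2 ^ j * t\<rfloor>"
    have i: "of_int i \<le> 2 ^ j * t" "2 ^ j * t < of_int i + 1" unfolding i_def by linarith+
    have "\<lfloor>2 ^ Suc j * t\<rfloor> = 2 * i \<or> \<lfloor>2 ^ Suc j * t\<rfloor> = 2 * i + 1"
      using i by (simp add: floor_eq_iff) linarith
    then show ?thesis using even[of j i] odd[of j i] unfolding f_def s_def i_def[symmetric] by auto
  qed
  have geo: "summable (\<lambda>k. C * q ^ (k + j))" "(\<Sum>k. C * q ^ (k + j)) = C / (1 - q) * q ^ j" for j
  proof -
    have "(\<lambda>k. C * q ^ j * q ^ k) sums (C * q ^ j * (1 / (1 - q)))"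
      using q by (intro sums_mult geometric_sums) auto
    then show "summable (\<lambda>k. C * q ^ (k + j))" "(\<Sum>k. C * q ^ (k + j)) = C / (1 - q) * q ^ j"
      by (simp_all add: sums_iff power_add mult_ac)
  qed
  have sf: "summable (f t)" for t
    using summable_comparison_test'[of "\<lambda>k. C * q ^ k" 0 "f t"] geo(1)[of 0] f by simp
  have close: "norm (c t - s j t) \<le> C / (1 - q) * q ^ j" for j t
  proof -
    have "s j t = s 0 t + (\<Sum>k<j. f t k)"
      by (induction j) (auto simp: f_def)
    then have "c t - s j t = (\<Sum>k. f t (k + j))"
      using suminf_minus_initial_segment[OF sf, of t j] by (simp add: c_def)
    also have "norm \<dots> \<le> (\<Sum>k. C * q ^ (k + j))"
      using f geo(1) by (intro norm_suminf_le) auto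
    finally show ?thesis by (simp add: geo(2))
  qed
  have "continuous_on UNIV c"
    unfolding continuous_on_iff
  proof (intro ballI allI impI)
    fix t e :: real assume "0 < e"
    \<comment> \<open>Two approximation errors and one jump between neighbouring intervals.\<close>
    define B where "B = C * (1 + 2 / (1 - q))"
    have "(\<lambda>j. B * q ^ j) \<longlonglongrightarrow> B * 0"
      using q by (intro tendsto_mult_left LIMSEQ_power_zero) auto
    then have "eventually (\<lambda>j. B * q ^ j < e) sequentially"
      using \<open>0 < e\<close> by (intro order_tendstoD(2)) auto
    then obtain j where j: "B * q ^ j < e" by (auto simp: eventually_sequentially)
    show "\<exists>d>0. \<forall>t'\<in>UNIV. dist t' t < d \<longrightarrow> dist (c t') (c t) < e"
    proof (intro exI[of _ "1 / 2 ^ j"] conjI ballI impI)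
      fix t' :: real assume "dist t' t < 1 / 2 ^ j"
      moreover have "\<bar>2 ^ j * t' - 2 ^ j * t\<bar> = 2 ^ j * \<bar>t' - t\<bar>"
        by (simp add: abs_mult flip: right_diff_distrib)
      ultimately have "\<bar>2 ^ j * t' - 2 ^ j * t\<bar> < 1"
        by (simp add: dist_real_def field_simps)
      then have "\<bar>\<lfloor>2 ^ j * t'\<rfloor> - \<lfloor>2 ^ j * t\<rfloor>\<bar> \<le> 1" by linarith
      then have "\<lfloor>2 ^ j * t'\<rfloor> = \<lfloor>2 ^ j * t\<rfloor> \<or> \<lfloor>2 ^ j * t'\<rfloor> = \<lfloor>2 ^ j * t\<rfloor> + 1 \<or> \<lfloor>2 ^ j * t\<rfloor> = \<lfloor>2 ^ j * t'\<rfloor> + 1"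
        by linarith
      moreover have "0 \<le> C * q ^ j" using step[of j 0] norm_ge_zero by (rule order_trans[rotated])
      ultimately have "norm (s j t' - s j t) \<le> C * q ^ j"
        using step[of j "\<lfloor>2 ^ j * t\<rfloor>"] step[of j "\<lfloor>2 ^ j * t'\<rfloor>"]
        unfolding s_def by (auto simp: norm_minus_commute)
      then have "norm (c t' - c t) \<le> C / (1 - q) * q ^ j + C * q ^ j + C / (1 - q) * q ^ j"
        using close[of t' j] close[of t j] norm_triangle_ineq[of "c t' - s j t'" "s j t' - s j t"]
          norm_triangle_ineq4[of "c t' - s j t" "c t - s j t"] by simp
      also have "\<dots> = B * q ^ j" by (simp add: B_def algebra_simps)
      finally show "dist (c t') (c t) < e" using j by (simp add: dist_norm)
    qed simp
  qed
  then show ?thesis using close[unfolded s_def] by (rule that)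
qed

text \<open>An interpolatory sequence of polygons whose vertices converge to a curve \<open>c\<close> and whose
  normalized chords converge to a continuous field \<open>T\<close>, uniformly. The limit curve is then \<open>G\<^sup>1\<close>
  with tangent field \<open>T\<close>.\<close>

locale dyadic_chords =
  fixes P :: "nat \<Rightarrow> int \<Rightarrow> real^3" and c T :: "real \<Rightarrow> real^3" and K q :: real
  assumes q: "0 \<le> q" "q < 1"
    and cont: "continuous_on UNIV c" "continuous_on UNIV T"
    and interp: "\<And>j i. P (Suc j) (2 * i) = P j i"
    and distinct: "\<And>j i. P j (i + 1) \<noteq> P j i"
    and close: "\<And>j t. norm (c t - P j \<lfloor>2 ^ j * t\<rfloor>) \<le> K * q ^ j"
    and chord: "\<And>j t. norm (T t - sgn (P j (\<lfloor>2 ^ j * t\<rfloor> + 1) - P j \<lfloor>2 ^ j * t\<rfloor>)) \<le> K * q ^ j"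
begin

lemma error_tendsto: "(\<lambda>j. K * q ^ j) \<longlonglongrightarrow> 0"
  using tendsto_mult_left[OF LIMSEQ_power_zero[of q], of K] q by simp

lemma dyadic_value: "c (of_int i / 2 ^ j) = P j i"
proof -
  have P: "P (j + m) (2 ^ m * i) = P j i" for m
    by (induction m) (simp_all add: interp mult.assoc)
  have "norm (c (of_int i / 2 ^ j) - P j i) \<le> K * q ^ (m + j)" for m
  proof -
    have "2 ^ (j + m) * (of_int i / 2 ^ j) = (of_int (2 ^ m * i) :: real)"
      by (simp add: power_add)
    then have "\<lfloor>2 ^ (j + m) * (of_int i / 2 ^ j) :: real\<rfloor> = 2 ^ m * i" by (simp only: floor_of_int)
    then show ?thesis using close[of "of_int i / 2 ^ j" "j + m"] P[of m] by (simp add: add.commute)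
  qed
  then have "norm (c (of_int i / 2 ^ j) - P j i) \<le> 0"
    by (intro LIMSEQ_le_const[OF LIMSEQ_ignore_initial_segment[OF error_tendsto, of j]]) auto
  then show ?thesis by simp
qed

lemma points_tendsto: "(\<lambda>j. P j \<lfloor>2 ^ j * t\<rfloor>) \<longlonglongrightarrow> c t"
proof -
  have "(\<lambda>j. P j \<lfloor>2 ^ j * t\<rfloor> - c t) \<longlonglongrightarrow> 0"
    by (rule tendsto_norm_zero_cancel, rule tendsto_sandwich[OF _ _ tendsto_const error_tendsto])
       (auto simp: norm_minus_commute[of _ "c t"] close)
  then show ?thesis by (simp add: LIM_zero_iff)
qed

lemma norm_tangent: "norm (T t) = 1"
proof -
  let ?D = "\<lambda>j. sgn (P j (\<lfloor>2 ^ j * t\<rfloor> + 1) - P j \<lfloor>2 ^ j * t\<rfloor>)"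
  have "(\<lambda>j. ?D j - T t) \<longlonglongrightarrow> 0"
    by (rule tendsto_norm_zero_cancel, rule tendsto_sandwich[OF _ _ tendsto_const error_tendsto])
       (auto simp: norm_minus_commute[of _ "T t"] chord)
  then have "(\<lambda>j. norm (?D j)) \<longlonglongrightarrow> norm (T t)" by (intro tendsto_norm) (simp add: LIM_zero_iff)
  moreover have "norm (?D j) = 1" for j using distinct[of j] by (simp add: norm_sgn)
  ultimately show ?thesis by (simp add: LIMSEQ_const_iff)
qed

text \<open>Near \<open>t\<close> all chords of fine polygons point almost in direction \<open>T t\<close>, that is, they lie in
  a circular cone around it. A convex cone contains sums of its elements and a closed one
  contains limits, so it contains all secants of the limit curve near \<open>t\<close>.\<close>

lemma secants_in_cone:
  assumes "0 < \<epsilon>" "\<epsilon> \<le> 1"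
  obtains \<eta> where "0 < \<eta>"
    "\<And>s1 s2. t - \<eta> < s1 \<Longrightarrow> s1 \<le> s2 \<Longrightarrow> s2 < t + \<eta> \<Longrightarrow>
       (1 - \<epsilon>) * norm (c s2 - c s1) \<le> (c s2 - c s1) \<bullet> T t"
proof -
  obtain d where d: "d > 0" "\<And>t'. \<bar>t' - t\<bar> < d \<Longrightarrow> norm (T t' - T t) < \<epsilon> / 2"
    using cont(2) half_gt_zero[OF assms(1)] unfolding continuous_on_iff dist_norm real_norm_def by blast
  show ?thesis
  proof (rule that[of "d / 2"])
    fix s1 s2 assume s: "t - d / 2 < s1" "s1 \<le> s2" "s2 < t + d / 2"
    have ev: "eventually (\<lambda>j. K * q ^ j < \<epsilon> / 2 \<and> (1/2) ^ j < d / 2) sequentially"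
      using assms d(1)
      by (intro eventually_conj order_tendstoD(2)[OF error_tendsto]
            order_tendstoD(2)[OF LIMSEQ_power_zero[of "1/2::real"]]) auto
    have "eventually (\<lambda>j. (1 - \<epsilon>) * norm (P j \<lfloor>2 ^ j * s2\<rfloor> - P j \<lfloor>2 ^ j * s1\<rfloor>)
        \<le> (P j \<lfloor>2 ^ j * s2\<rfloor> - P j \<lfloor>2 ^ j * s1\<rfloor>) \<bullet> T t) sequentially"
      using ev
    proof eventually_elim
      case (elim j)
      define a where "a = \<lfloor>2 ^ j * s1\<rfloor>"
      have edge: "(1 - \<epsilon>) * norm (P j (i + 1) - P j i) \<le> (P j (i + 1) - P j i) \<bullet> T t"
        if i: "a \<le> i" "i < \<lfloor>2 ^ j * s2\<rfloor>" for i
      proof -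
        let ?D = "sgn (P j (i + 1) - P j i)" and ?t = "of_int i / 2 ^ j :: real"
        have "of_int i \<le> 2 ^ j * s2" "2 ^ j * s1 - 1 < of_int i" using i unfolding a_def by linarith+
        then have "?t \<le> s2" "s1 < (of_int i + 1) / 2 ^ j" by (simp_all add: field_simps)
        then have "?t \<le> s2" "s1 - 1 / 2 ^ j < ?t" by (simp_all add: add_divide_distrib)
        moreover have "1 / 2 ^ j < d / 2" using elim by (simp add: power_one_over)
        ultimately have "\<bar>?t - t\<bar> < d" using s by linarith
        then have "norm (T ?t - T t) < \<epsilon> / 2" by (rule d(2))
        moreover have "norm (T ?t - ?D) < \<epsilon> / 2" using chord[of ?t j] elim by simp
        ultimately have D: "norm (?D - T t) < \<epsilon>"
          using norm_triangle_ineq4[of "T ?t - T t" "T ?t - ?D"] by simp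
        have "?D \<bullet> T t = T t \<bullet> T t + (?D - T t) \<bullet> T t" by (simp add: inner_diff_left)
        moreover have "T t \<bullet> T t = 1" using norm_tangent[of t] by (simp add: norm_eq_1)
        moreover have "\<bar>(?D - T t) \<bullet> T t\<bar> \<le> norm (?D - T t)"
          using Cauchy_Schwarz_ineq2[of "?D - T t" "T t"] norm_tangent[of t] by simp
        ultimately have "1 - \<epsilon> \<le> ?D \<bullet> T t" using D by linarith
        then have "norm (P j (i + 1) - P j i) * (1 - \<epsilon>) \<le> norm (P j (i + 1) - P j i) * (?D \<bullet> T t)"
          by (intro mult_left_mono) auto
        also have "\<dots> = (P j (i + 1) - P j i) \<bullet> T t"
          using distinct[of j i] by (simp add: sgn_div_norm)
        finally show ?thesis by (simp add: mult.commute)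
      qed
      have "b \<le> \<lfloor>2 ^ j * s2\<rfloor> \<longrightarrow> (1 - \<epsilon>) * norm (P j b - P j a) \<le> (P j b - P j a) \<bullet> T t" if "a \<le> b" for b
        using that
      proof (induction b rule: int_ge_induct)
        case (step b)
        show ?case
        proof
          assume b: "b + 1 \<le> \<lfloor>2 ^ j * s2\<rfloor>"
          let ?u = "P j b - P j a" and ?v = "P j (b + 1) - P j b"
          have "0 \<le> 1 - \<epsilon> \<Longrightarrow> (1 - \<epsilon>) * norm (?u + ?v) \<le> (1 - \<epsilon>) * norm ?u + (1 - \<epsilon>) * norm ?v"
            using norm_triangle_ineq[of ?u ?v] by (simp add: mult_left_mono flip: distrib_left)
          moreover have "(1 - \<epsilon>) * norm ?u \<le> ?u \<bullet> T t" using step.IH b by simp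
          moreover have "(1 - \<epsilon>) * norm ?v \<le> ?v \<bullet> T t" using edge[of b] step.hyps b by simp
          ultimately have "(1 - \<epsilon>) * norm (?u + ?v) \<le> (?u + ?v) \<bullet> T t"
            using assms(2) unfolding inner_add_left by linarith
          then show "(1 - \<epsilon>) * norm (P j (b + 1) - P j a) \<le> (P j (b + 1) - P j a) \<bullet> T t"
            by simp
        qed
      qed simp
      moreover have "a \<le> \<lfloor>2 ^ j * s2\<rfloor>" unfolding a_def using s by (intro floor_mono) auto
      ultimately show ?case unfolding a_def by blast
    qed
    then show "(1 - \<epsilon>) * norm (c s2 - c s1) \<le> (c s2 - c s1) \<bullet> T t"
      by (intro tendsto_le[OF trivial_limit_sequentially _ _]) (auto intro!: tendsto_intros points_tendsto)
  qed (use d in simp)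
qed

text \<open>An element of a narrow cone is close to the axis after normalization unless it is zero.
  Secants are nonzero: some edge of a fine polygon lies between the two parameters, and it makes
  a positive contribution in the direction \<open>T t\<close> that the rest of the curve, moving inside the
  cone, cannot undo.\<close>

lemma sgn_secants:
  fixes e :: real
  assumes "0 < e"
  obtains \<eta> where "0 < \<eta>"
    "\<And>s1 s2. t - \<eta> < s1 \<Longrightarrow> s1 < s2 \<Longrightarrow> s2 < t + \<eta> \<Longrightarrow> norm (sgn (c s2 - c s1) - T t) < e"
proof -
  \<comment> \<open>Unit vectors with inner product at least \<open>1 - \<epsilon>\<close> differ by at most \<open>sqrt (2 * \<epsilon>)\<close>.\<close>
  define \<epsilon> where "\<epsilon> = min (1/2) (e\<^sup>2 / 4)"
  have \<epsilon>: "0 < \<epsilon>" "\<epsilon> < 1" "2 * \<epsilon> < e\<^sup>2" using assms by (auto simp: \<epsilon>_def min_def)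
  obtain \<eta> where \<eta>: "0 < \<eta>" and cone: "\<And>s1 s2. t - \<eta> < s1 \<Longrightarrow> s1 \<le> s2 \<Longrightarrow> s2 < t + \<eta> \<Longrightarrow>
       (1 - \<epsilon>) * norm (c s2 - c s1) \<le> (c s2 - c s1) \<bullet> T t"
    using secants_in_cone[of \<epsilon> t] \<epsilon> by (metis less_imp_le)
  show ?thesis
  proof (rule that[OF \<eta>])
    fix s1 s2 assume s: "t - \<eta> < s1" "s1 < s2" "s2 < t + \<eta>"
    have nonneg: "0 \<le> (c y - c x) \<bullet> T t" if "s1 \<le> x" "x \<le> y" "y \<le> s2" for x y
    proof -
      have "0 \<le> (1 - \<epsilon>) * norm (c y - c x)" using \<epsilon> by simp
      also have "\<dots> \<le> (c y - c x) \<bullet> T t" using that s by (intro cone) auto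
      finally show ?thesis .
    qed
    obtain j :: nat where j: "(1/2) ^ j < (s2 - s1) / 2"
      using real_arch_pow_inv[of "(s2 - s1) / 2" "1/2"] s by auto
    define i where "i = \<lceil>2 ^ j * s1\<rceil>"
    define a b :: real where "a = of_int i / 2 ^ j" and "b = of_int (i + 1) / 2 ^ j"
    have "2 ^ j * s1 \<le> of_int i" "of_int (i + 1) < 2 ^ j * s1 + 2" unfolding i_def by linarith+
    then have "2 ^ j * s1 / 2 ^ j \<le> a" "b < (2 ^ j * s1 + 2) / 2 ^ j"
      unfolding a_def b_def by (intro divide_right_mono divide_strict_right_mono; simp)+
    then have "s1 \<le> a" "b < s1 + 2 * (1/2) ^ j"
      by (simp_all add: add_divide_distrib power_one_over)
    moreover have "a \<le> b" by (simp add: a_def b_def divide_right_mono)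
    ultimately have ab: "s1 \<le> a" "a \<le> b" "b \<le> s2" using j by auto
    have "0 < (1 - \<epsilon>) * norm (c b - c a)"
      using distinct[of j i] \<epsilon> unfolding a_def b_def dyadic_value by simp
    also have "\<dots> \<le> (c b - c a) \<bullet> T t" using ab s by (intro cone) auto
    also have "\<dots> \<le> (c s2 - c b) \<bullet> T t + (c b - c a) \<bullet> T t + (c a - c s1) \<bullet> T t"
      using nonneg[of b s2] nonneg[of s1 a] ab by simp
    also have "\<dots> = (c s2 - c s1) \<bullet> T t" by (simp add: inner_diff_left)
    finally have ne: "c s2 - c s1 \<noteq> 0" by auto
    let ?u = "sgn (c s2 - c s1)"
    have u: "1 - \<epsilon> \<le> ?u \<bullet> T t"
      using cone[of s1 s2] s ne by (simp add: sgn_div_norm pos_le_divide_eq inverse_eq_divide)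
    have "(norm (?u - T t))\<^sup>2 = (norm ?u)\<^sup>2 + (norm (T t))\<^sup>2 - 2 * (?u \<bullet> T t)"
      by (simp add: power2_norm_eq_inner inner_diff inner_commute)
    also have "\<dots> = 2 - 2 * (?u \<bullet> T t)" using ne by (simp add: norm_sgn norm_tangent)
    also have "\<dots> < e\<^sup>2" using u \<epsilon>(3) by linarith
    finally show "norm (?u - T t) < e" using assms by (simp add: power_less_imp_less_base)
  qed
qed

lemma G1: "G1_continuous c"
  unfolding G1_continuous_def
proof (intro conjI exI[of _ T] allI cont norm_tangent)
  fix t
  show "((\<lambda>s. sgn (c s - c t)) \<longlongrightarrow> T t) (at_right t)"
  proof (rule tendstoI)
    fix e :: real assume "0 < e"
    then obtain \<eta> where \<eta>: "0 < \<eta>" "\<And>s1 s2. t - \<eta> < s1 \<Longrightarrow> s1 < s2 \<Longrightarrow> s2 < t + \<eta> \<Longrightarrow> norm (sgn (c s2 - c s1) - T t) < e"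
      using sgn_secants by blast
    show "\<forall>\<^sub>F s in at_right t. dist (sgn (c s - c t)) (T t) < e"
      unfolding eventually_at_right_field
      using \<eta> by (intro exI[of _ "t + \<eta>"]) (auto simp: dist_norm)
  qed
  show "((\<lambda>s. sgn (c t - c s)) \<longlongrightarrow> T t) (at_left t)"
  proof (rule tendstoI)
    fix e :: real assume "0 < e"
    then obtain \<eta> where \<eta>: "0 < \<eta>" "\<And>s1 s2. t - \<eta> < s1 \<Longrightarrow> s1 < s2 \<Longrightarrow> s2 < t + \<eta> \<Longrightarrow> norm (sgn (c s2 - c s1) - T t) < e"
      using sgn_secants by blast
    show "\<forall>\<^sub>F s in at_left t. dist (sgn (c t - c s)) (T t) < e"
      unfolding eventually_at_left_field
      using \<eta> by (intro exI[of _ "t - \<eta>"]) (auto simp: dist_norm)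
  qed
qed

end

section \<open>The limit curve of a tame initial polygon\<close>

definition edge_length :: "(int \<Rightarrow> real^3) \<Rightarrow> int \<Rightarrow> real" where
  "edge_length P i = geo_dist (P i) (P (i + 1))"

definition edge_direction :: "(int \<Rightarrow> real^3) \<Rightarrow> int \<Rightarrow> real^3" where
  "edge_direction P i = start_tangent (P i) (P (i + 1))"

lemma framed_polygon_canonical:
  assumes "framed_polygon P W l \<delta>"
  shows "W = edge_direction P" "l = edge_length P" "\<delta> = angular_defect P"
  using framed_polygon_data[OF assms]
  by (auto simp: edge_direction_def edge_length_def fun_eq_iff)

text \<open>A starting polygon which satisfies the invariant of the refinement, and hence does so at
  every level.\<close>

locale tame_start =
  fixes P0 :: "int \<Rightarrow> real^3"
  assumes framed0: "framed_polygon P0 (edge_direction P0) (edge_length P0) (angular_defect P0)"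
    and controlled0: "controlled 0 (edge_length P0) (angular_defect P0)"
begin

abbreviation P where "P \<equiv> sbigs P0"
abbreviation W where "W j \<equiv> edge_direction (P j)"
abbreviation l where "l j \<equiv> edge_length (P j)"
abbreviation \<delta> where "\<delta> j \<equiv> angular_defect (P j)"

lemma step_framed:
  assumes fr: "framed_polygon (P j) (W j) (l j) (\<delta> j)" and co: "controlled j (l j) (\<delta> j)"
  shows "framed_polygon (P (Suc j)) (W (Suc j)) (l (Suc j)) (\<delta> (Suc j))"
    "l (Suc j) = refined_length (l j) (\<delta> j)" "\<delta> (Suc j) = refined_defect (l j) (\<delta> j)"
    "W (Suc j) (2 * i) = turn (P j i) (base_angle (\<delta> j) i) (W j i)"
proof -
  have Suc: "P (Suc j) = sbigs_step (P j)" by (simp add: sbigs_def)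
  have "\<bar>\<delta> j i\<bar> \<le> 1" for i
  proof -
    have "\<bar>\<delta> j i\<bar> \<le> (3/4) ^ j" using co unfolding controlled_def by blast
    also have "\<dots> \<le> 1" by (intro power_le_one) auto
    finally show ?thesis .
  qed
  then obtain W' where W': "framed_polygon (P (Suc j)) W' (refined_length (l j) (\<delta> j)) (refined_defect (l j) (\<delta> j))"
    "\<And>i. W' (2 * i) = turn (P j i) (base_angle (\<delta> j) i) (W j i)"
    unfolding Suc using framed_polygon_sbigs_step[OF fr] by blast
  note * = framed_polygon_canonical[OF W'(1)]
  show "framed_polygon (P (Suc j)) (W (Suc j)) (l (Suc j)) (\<delta> (Suc j))"
    using W'(1) unfolding * .
  show "l (Suc j) = refined_length (l j) (\<delta> j)" "\<delta> (Suc j) = refined_defect (l j) (\<delta> j)"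
    using *(2,3) by simp_all
  show "W (Suc j) (2 * i) = turn (P j i) (base_angle (\<delta> j) i) (W j i)"
    using W'(2) *(1) by simp
qed

lemma framed: "framed_polygon (P j) (W j) (l j) (\<delta> j)"
  and controlled: "controlled j (l j) (\<delta> j)"
proof (induction j)
  case 0
  show "framed_polygon (P 0) (W 0) (l 0) (\<delta> 0)" "controlled 0 (l 0) (\<delta> 0)"
    using framed0 controlled0 by (simp_all add: sbigs_def)
next
  case (Suc j)
  show "framed_polygon (P (Suc j)) (W (Suc j)) (l (Suc j)) (\<delta> (Suc j))"
    by (rule step_framed(1)[OF Suc])
  show "controlled (Suc j) (l (Suc j)) (\<delta> (Suc j))"
    unfolding step_framed(2,3)[OF Suc] by (rule controlled_refine[OF Suc(2)])
qed

lemmas framedD = framed_polygonD[OF framed]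
lemmas refine = step_framed(2-4)[OF framed controlled]

lemma interp: "P (Suc j) (2 * i) = P j i"
  by (simp add: sbigs_def sbigs_step_def)

lemma length_lt_pi: "l j i < pi" using framedD(3)[of j i] pi_gt_zero by linarith

lemma length_le: "l j i \<le> 2 / 2 ^ j"
proof -
  have "l j i \<le> tan (l j i)"
    using abs_tan_ge[of "l j i"] framedD(2,3)[of j i] tan_pos_pi2_le[of "l j i"] by simp
  also have "\<dots> \<le> (2 - (3/4) ^ j) / 2 ^ j" using controlled unfolding controlled_def by blast
  also have "\<dots> \<le> 2 / 2 ^ j" by (intro divide_right_mono) auto
  finally show ?thesis .
qed

lemma length_le_geometric: "l j i \<le> 2 * (3/4) ^ j"
proof -
  have "(1/2 :: real) ^ j \<le> (3/4) ^ j" by (intro power_mono) auto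
  then show ?thesis using length_le[of j i] by (simp add: power_one_over)
qed

lemma defect_le: "\<bar>\<delta> j i\<bar> \<le> (3/4) ^ j"
  using controlled unfolding controlled_def by blast

lemma defect_le_one: "\<bar>\<delta> j i\<bar> \<le> 1"
  using defect_le[of j i] by (rule order_trans) (auto intro: power_le_one)

lemma point_step: "norm (P j (i + 1) - P j i) \<le> 2 * (3/4) ^ j"
  using norm_arc_point_diff[OF framedD(1), of j i "l j i"] framedD(2,5)[of j i] length_le_geometric[of j i]
  by simp

lemma direction_step: "norm (W j (i + 1) - W j i) \<le> 3 * (3/4) ^ j"
proof -
  have "norm (arc_tangent (P j i) (W j i) (l j i) - W j i) \<le> 2 * (3/4) ^ j"
    using norm_arc_tangent_diff[OF framedD(1), of j i "l j i"] framedD(2)[of j i] length_le_geometric[of j i] by simp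
  moreover have "norm (arc_tangent (P j i) (W j i) (l j i) - W j (i + 1)) \<le> (3/4) ^ j"
    unfolding framedD(6) using norm_turn_diff[OF framedD(1)] defect_le by (rule order_trans)
  ultimately show ?thesis
    using norm_triangle_le_diff[of "arc_tangent (P j i) (W j i) (l j i) - W j i" "arc_tangent (P j i) (W j i) (l j i) - W j (i + 1)" "3 * (3/4) ^ j"]
    by simp
qed

text \<open>Vertices move by at most an edge length per level; directions turn by a base angle at old
  vertices, and by defects and edge lengths from one edge to the next. All of these decay
  geometrically.\<close>

lemma limit_G1:
  obtains c where "sbigs_limit_curve P0 c" "G1_continuous c" "\<And>j i. c (of_int i / 2 ^ j) = P j i"
proof -
  have q: "0 \<le> (3/4::real)" "(3/4::real) < 1" by simp_all
  have pw: "(3/4::real) ^ Suc j \<le> (3/4) ^ j" "0 \<le> (3/4::real) ^ j" for j by simp_all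
  obtain c where c: "continuous_on UNIV c"
    "\<And>j (t :: real). norm (c t - P j \<lfloor>2 ^ j * t\<rfloor>) \<le> 4 / (1 - 3/4) * (3/4) ^ j"
  proof (rule dyadic_limit[where x = P and C = 4, OF q])
    fix j i
    show "norm (P (Suc j) (2 * i) - P j i) \<le> 4 * (3/4) ^ j" by (simp add: interp)
    show "norm (P (Suc j) (2 * i + 1) - P j i) \<le> 4 * (3/4) ^ j"
      using point_step[of "Suc j" "2 * i"] pw[of j] unfolding interp by linarith
    show "norm (P j (i + 1) - P j i) \<le> 4 * (3/4) ^ j" using point_step[of j i] pw[of j] by linarith
  qed blast
  obtain T where T: "continuous_on UNIV T"
    "\<And>j (t :: real). norm (T t - W j \<lfloor>2 ^ j * t\<rfloor>) \<le> 4 / (1 - 3/4) * (3/4) ^ j"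
  proof (rule dyadic_limit[where x = W and C = 4, OF q])
    fix j i
    have a: "\<bar>base_angle (\<delta> j) i\<bar> \<le> (3/4) ^ j / 4"
      using defect_le[of j i] defect_le[of j "i + 1"] by (simp add: base_angle_def abs_le_iff)
    have even: "norm (W (Suc j) (2 * i) - W j i) \<le> (3/4) ^ j / 4"
      unfolding refine using norm_turn_diff[OF framedD(1)] a by (rule order_trans)
    show "norm (W (Suc j) (2 * i) - W j i) \<le> 4 * (3/4) ^ j" using even pw[of j] by linarith
    have "norm (W (Suc j) (2 * i + 1) - W j i)
        \<le> norm (W (Suc j) (2 * i + 1) - W (Suc j) (2 * i)) + norm (W (Suc j) (2 * i) - W j i)"
      using norm_triangle_ineq[of "W (Suc j) (2 * i + 1) - W (Suc j) (2 * i)" "W (Suc j) (2 * i) - W j i"]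
      by simp
    then show "norm (W (Suc j) (2 * i + 1) - W j i) \<le> 4 * (3/4) ^ j"
      using direction_step[of "Suc j" "2 * i"] even pw[of j] by linarith
    show "norm (W j (i + 1) - W j i) \<le> 4 * (3/4) ^ j" using direction_step[of j i] pw[of j] by linarith
  qed blast
  \<comment> \<open>\<open>18 = 16 + 2\<close>: an edge direction is off its limit by at most 16 units \<open>(3/4) ^ j\<close>
    and off the normalized chord by at most an edge length, which is 2 units.\<close>
  interpret dyadic_chords P c T 18 "3/4"
  proof
    fix j i and t :: real
    show "P j (i + 1) \<noteq> P j i"
      unfolding framedD(5)[of j i] by (rule arc_point_distinct(1)[OF framedD(1,2) length_lt_pi])
    show "norm (c t - P j \<lfloor>2 ^ j * t\<rfloor>) \<le> 18 * (3/4) ^ j"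
      by (rule order_trans[OF c(2)]) (use pw(2)[of j] in simp)
    define k where "k = \<lfloor>2 ^ j * t\<rfloor>"
    have "norm (sgn (P j (k + 1) - P j k) - W j k) \<le> 2 * (3/4) ^ j"
      unfolding framedD(5) using sgn_chord[OF framedD(1,2) length_lt_pi] length_le_geometric
      by (rule order_trans)
    moreover have "norm (T t - W j k) \<le> 16 * (3/4) ^ j" using T(2)[of t j] by (simp add: k_def)
    ultimately show "norm (T t - sgn (P j (\<lfloor>2 ^ j * t\<rfloor> + 1) - P j \<lfloor>2 ^ j * t\<rfloor>)) \<le> 18 * (3/4) ^ j"
      unfolding k_def[symmetric]
      using norm_triangle_le_diff[of "T t - W j k" "sgn (P j (k + 1) - P j k) - W j k" "18 * (3/4) ^ j"]
      by simp
  qed (use q c T interp in auto)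
  have "sbigs_limit_curve P0 c"
    unfolding sbigs_limit_curve_def
  proof (rule uniform_limitI)
    fix e :: real assume "0 < e"
    have "(\<lambda>j. 20 * (3/4 :: real) ^ j) \<longlonglongrightarrow> 20 * 0"
      by (intro tendsto_mult_left LIMSEQ_power_zero) auto
    then have "eventually (\<lambda>j. 20 * (3/4 :: real) ^ j < e) sequentially"
      using \<open>0 < e\<close> by (intro order_tendstoD(2)) auto
    then show "\<forall>\<^sub>F j in sequentially. \<forall>t\<in>UNIV. dist (polygon_curve j (P j) t) (c t) < e"
    proof eventually_elim
      case (elim j)
      show ?case
      proof
        fix t :: real
        define i where "i = \<lfloor>2 ^ j * t\<rfloor>"
        define s where "s = (2 ^ j * t - of_int i) * l j i"
        have "0 \<le> 2 ^ j * t - of_int i" "2 ^ j * t - of_int i \<le> 1" unfolding i_def by linarith+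
        then have s: "\<bar>s\<bar> \<le> l j i"
          using framedD(2)[of j i] by (simp add: s_def mult_left_le_one_le)
        have "polygon_curve j (P j) t = geodesic (P j i) (P j (i + 1)) s"
          by (simp add: polygon_curve_def Let_def i_def s_def edge_length_def)
        also have "\<dots> = arc_point (P j i) (W j i) s"
          unfolding framedD(5)[of j i] by (rule geodesic_arc_point[OF framedD(1,2) length_lt_pi])
        finally have "norm (polygon_curve j (P j) t - P j i) \<le> 2 * (3/4) ^ j"
          using norm_arc_point_diff[OF framedD(1), of j i s] s length_le_geometric[of j i] by simp
        moreover have "norm (c t - P j i) \<le> 18 * (3/4) ^ j" using close[of t j] by (simp add: i_def)
        ultimately show "dist (polygon_curve j (P j) t) (c t) < e"
          using elim norm_triangle_le_diff[of "polygon_curve j (P j) t - P j i" "c t - P j i" "20 * (3/4) ^ j"]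
          by (simp add: dist_norm)
      qed
    qed
  qed
  then show ?thesis using G1 dyadic_value by (rule that)
qed

text \<open>The defect is measured from the outgoing to the incoming direction, the discrete curvature
  the other way round; hence the sign.\<close>

lemma curvature_level:
  "discrete_curvature (P j (-1)) (P j 0) (P j 1) = - 2 * \<delta> j 0 / (l j (-1) + l j 0)"
proof -
  have "start_tangent (P j 0) (P j 1) = W j 0" "end_tangent (P j (-1)) (P j 0) = turn (P j 0) (\<delta> j 0) (W j 0)"
    using framed_polygon_data(2,3)[OF framed, of j 0] by simp_all
  moreover have "signed_angle (P j 0) (turn (P j 0) (\<delta> j 0) (W j 0)) (W j 0) = - \<delta> j 0"
    using framedD(4)[of j 0] by (intro signed_angle_turn_left framedD(1)) linarith+
  ultimately show ?thesis
    by (simp add: discrete_curvature_def edge_length_def)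
qed

text \<open>The instability of the scheme. Let \<open>x = 2 ^ j * \<delta> j 0\<close> be the scaled defect at vertex 0
  and \<open>y\<close> the scaled sum of the defects at its two neighbours. In the planar linear scheme the
  next pair is \<open>(x + (2 * x - y) / 4, x + y / 2)\<close>: the matrix has the double eigenvalue 1 but is
  not diagonalizable, \<open>2 * x - y\<close> is preserved, and \<open>x\<close> grows linearly. On the sphere the apex
  defects are at most those of the plane as long as they are nonnegative, so \<open>y\<close> only becomes
  smaller and \<open>2 * x - y\<close> can only increase.\<close>

lemma defect_growth:
  assumes "0 \<le> \<delta> 0 (-1)" "0 \<le> \<delta> 0 1" "0 < \<kappa>" "\<kappa> \<le> 2 * \<delta> 0 0 - \<delta> 0 (-1) - \<delta> 0 1"
  shows "0 \<le> \<delta> j (-1) \<and> 0 \<le> \<delta> j 1 \<and> \<kappa> \<le> 2 ^ j * (2 * \<delta> j 0 - \<delta> j (-1) - \<delta> j 1) \<and>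
    \<kappa> / 4 * real j \<le> 2 ^ j * \<delta> j 0"
proof (induction j)
  case 0
  then show ?case using assms by simp
next
  case (Suc j)
  define a b b' where "a = \<delta> j 0" and "b = \<delta> j (-1)" and "b' = \<delta> j 1"
  have IH: "0 \<le> b" "0 \<le> b'" "\<kappa> \<le> 2 ^ j * (2 * a - b - b')" "\<kappa> / 4 * real j \<le> 2 ^ j * a"
    using Suc by (simp_all add: a_def b_def b'_def)
  have a: "0 \<le> a"
  proof -
    have "0 \<le> 2 ^ j * a" using IH(4) assms(3) by (intro order_trans[OF _ IH(4)]) auto
    then show ?thesis by (intro mult_left_le_imp_le[of "2 ^ j" 0 a]) simp_all
  qed
  have ba: "base_angle (\<delta> j) (-1) = (b + a) / 8" "base_angle (\<delta> j) 0 = (a + b') / 8"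
    by (simp_all add: base_angle_def a_def b_def b'_def)
  have small: "a \<le> 1" "b \<le> 1" "b' \<le> 1"
    using defect_le_one[of j 0] defect_le_one[of j "-1"] defect_le_one[of j 1]
    unfolding a_def b_def b'_def by linarith+
  have apex: "0 \<le> apex_defect (l j) (\<delta> j) i \<and> apex_defect (l j) (\<delta> j) i \<le> 2 * base_angle (\<delta> j) i"
    if "0 \<le> base_angle (\<delta> j) i" "base_angle (\<delta> j) i \<le> 1/4" for i
  proof -
    have c: "0 \<le> cos (leg (l j) (\<delta> j) i)" "cos (leg (l j) (\<delta> j) i) \<le> 1"
      by (simp_all only: cos_le_one) (simp add: leg_def cos_arctan)
    have "base_angle (\<delta> j) i < pi / 2" using that(2) pi_gt3 by linarith
    note B = arctan_mult_tan_bounds[OF c that(1) this]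
    have "0 \<le> cos (leg (l j) (\<delta> j) i) * base_angle (\<delta> j) i" using c that by simp
    then show ?thesis using B unfolding apex_defect_def by linarith
  qed
  have d0: "\<delta> (Suc j) 0 = (6 * a - b - b') / 8"
    unfolding refine using refined_defect_even[of "l j" "\<delta> j" 0] by (simp add: a_def b_def b'_def)
  have d1: "\<delta> (Suc j) 1 = apex_defect (l j) (\<delta> j) 0" "\<delta> (Suc j) (-1) = apex_defect (l j) (\<delta> j) (-1)"
    unfolding refine using refined_defect_odd[of "l j" "\<delta> j"  0] refined_defect_odd[of "l j" "\<delta> j" "-1"] by simp_all
  have b: "0 \<le> \<delta> (Suc j) (-1)" "\<delta> (Suc j) (-1) \<le> (b + a) / 4" "0 \<le> \<delta> (Suc j) 1" "\<delta> (Suc j) 1 \<le> (a + b') / 4"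
    unfolding d1 using apex[of 0] apex[of "-1"] IH a small unfolding ba by simp_all
  have "\<kappa> \<le> 2 ^ j * (2 * a - b - b')" by (rule IH(3))
  also have "\<dots> \<le> 2 ^ j * (2 * (2 * \<delta> (Suc j) 0 - \<delta> (Suc j) (-1) - \<delta> (Suc j) 1))"
    using b unfolding d0 by (intro mult_left_mono) (auto simp: field_simps)
  finally have K: "\<kappa> \<le> 2 ^ Suc j * (2 * \<delta> (Suc j) 0 - \<delta> (Suc j) (-1) - \<delta> (Suc j) 1)"
    by (simp add: algebra_simps)
  have "2 ^ Suc j * \<delta> (Suc j) 0 = 2 ^ j * a + 2 ^ j * (2 * a - b - b') / 4"
    unfolding d0 by (simp add: field_simps)
  moreover have "\<kappa> / 4 * real (Suc j) = \<kappa> / 4 * real j + \<kappa> / 4"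
    by (simp add: algebra_simps)
  ultimately have "\<kappa> / 4 * real (Suc j) \<le> 2 ^ Suc j * \<delta> (Suc j) 0"
    using IH(3,4) by linarith
  with K b show ?case by simp
qed

text \<open>The polygon points next to vertex 0 lie on the limit curve and approach it from both
  sides. The edges at vertex 0 are \<open>O(1 / 2 ^ j)\<close>, hence the discrete curvatures at these points
  grow at least linearly with the level.\<close>

lemma no_curvature:
  assumes "0 \<le> \<delta> 0 (-1)" "0 \<le> \<delta> 0 1" "\<delta> 0 (-1) + \<delta> 0 1 < 2 * \<delta> 0 0"
    and c: "\<And>j i. c (of_int i / 2 ^ j) = P j i"
  shows "\<not> has_geodesic_curvature c 0 k"
proof
  assume "has_geodesic_curvature c 0 k"
  define \<kappa> where "\<kappa> = 2 * \<delta> 0 0 - \<delta> 0 (-1) - \<delta> 0 1"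
  have \<kappa>: "0 < \<kappa>" using assms by (simp add: \<kappa>_def)
  have h: "(\<lambda>j. (1/2 :: real) ^ j) \<longlonglongrightarrow> 0" by (intro LIMSEQ_power_zero) auto
  have "filterlim (\<lambda>j. - ((1/2 :: real) ^ j)) (at_left 0) sequentially"
    unfolding filterlim_at using tendsto_minus[OF h] by simp
  moreover have "filterlim (\<lambda>j. (1/2 :: real) ^ j) (at_right 0) sequentially"
    unfolding filterlim_at using h by simp
  ultimately have "filterlim (\<lambda>j. (- ((1/2 :: real) ^ j), (1/2 :: real) ^ j)) (at_left 0 \<times>\<^sub>F at_right 0) sequentially"
    by (rule filterlim_Pair)
  from filterlim_compose[OF \<open>has_geodesic_curvature c 0 k\<close>[unfolded has_geodesic_curvature_def] this]
  have "(\<lambda>j. discrete_curvature (c (- ((1/2) ^ j))) (c 0) (c ((1/2) ^ j))) \<longlonglongrightarrow> k" by simp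
  moreover have "discrete_curvature (c (- ((1/2) ^ j))) (c 0) (c ((1/2) ^ j)) = - 2 * \<delta> j 0 / (l j (-1) + l j 0)" for j
    using c[of "-1" j] c[of 0 j] c[of 1 j] curvature_level[of j] by (simp add: power_one_over)
  ultimately have "(\<lambda>j. - 2 * \<delta> j 0 / (l j (-1) + l j 0)) \<longlonglongrightarrow> k" by simp
  then have "Bseq (\<lambda>j. - 2 * \<delta> j 0 / (l j (-1) + l j 0))" by (intro convergent_imp_Bseq convergentI)
  then obtain B where B: "\<And>j. \<bar>- 2 * \<delta> j 0 / (l j (-1) + l j 0)\<bar> \<le> B"
    by (auto simp: Bseq_def)
  have "\<kappa> / 8 * real j \<le> B" for j
  proof -
    have g: "\<kappa> / 4 * real j \<le> 2 ^ j * \<delta> j 0"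
      using defect_growth[of \<kappa> j] assms \<kappa> by (simp add: \<kappa>_def)
    have "0 \<le> \<kappa> / 4 * real j" using \<kappa> by simp
    then have "0 \<le> 2 ^ j * \<delta> j 0" using g by linarith
    then have d: "0 \<le> \<delta> j 0" by (intro mult_left_le_imp_le[of "2 ^ j" 0 "\<delta> j 0"]) simp_all
    have L: "0 < l j (-1) + l j 0" "l j (-1) + l j 0 \<le> 4 / 2 ^ j"
      using framedD(2)[of j "-1"] framedD(2)[of j 0] length_le[of j "-1"] length_le[of j 0] by simp_all
    have "\<kappa> / 8 * real j \<le> 2 * \<delta> j 0 / (4 / 2 ^ j)" using g by (simp add: mult_ac)
    also have "\<dots> \<le> 2 * \<delta> j 0 / (l j (-1) + l j 0)"
      using d L by (intro divide_left_mono) auto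
    also have "\<dots> \<le> B" using B[of j] by linarith
    finally show ?thesis .
  qed
  moreover obtain j :: nat where "B * 8 / \<kappa> < real j" using reals_Archimedean2 by blast
  ultimately have "\<kappa> / 8 * real j \<le> B" "B * 8 / \<kappa> < real j" by blast+
  then show False using \<kappa> by (simp add: field_simps)
qed

end

section \<open>A great circle broken at one vertex\<close>

text \<open>The initial polygon consists of two great circle rays with edges of length \<open>pi / 4\<close> that
  meet in vertex 0 under the defect 1. All other defects vanish, so that the hypotheses on
  growth and on smallness are both immediate. Negative vertices are reached by walking backwards
  from vertex 0.\<close>

definition bent_side :: "int \<Rightarrow> real^3" where
  "bent_side i = (if 0 \<le> i then axis 2 1 else cos 1 *\<^sub>R axis 2 1 + sin 1 *\<^sub>R axis 3 1)"

definition bent_polygon :: "int \<Rightarrow> real^3" where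
  "bent_polygon i = arc_point (axis 1 1) (bent_side i) (of_int i * (pi / 4))"

lemma bent_framed:
  "framed_polygon bent_polygon (\<lambda>i. arc_tangent (axis 1 1) (bent_side i) (of_int i * (pi / 4)))
     (\<lambda>i. pi / 4) (\<lambda>i. if i = 0 then 1 else 0)"
proof -
  have cr: "axis 1 1 \<times> axis 2 1 = (axis 3 1 :: real^3)"
    by (simp add: cross3_def vec_eq_iff forall_3 axis_def)
  have fr0: "unit_tangent (axis 1 1) (axis 2 1)" by (simp add: unit_tangent_def inner_axis_axis)
  have b: "bent_side i = (if 0 \<le> i then axis 2 1 else turn (axis 1 1) 1 (axis 2 1))" for i
    by (simp add: bent_side_def turn_def cr)
  have fr: "unit_tangent (axis 1 1) (bent_side i)" for i
    unfolding b using fr0 unit_tangent_turn[OF fr0] by simp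
  have move: "arc_point (arc_point p w s) (arc_tangent p w s) t = arc_point p w (s + t)"
    "arc_tangent (arc_point p w s) (arc_tangent p w s) t = arc_tangent p w (s + t)" for p w :: "real^3" and s t
    by (simp_all add: arc_point_def arc_tangent_def cos_add sin_add algebra_simps)
  have turn0: "turn p 0 w = w" for p w :: "real^3" by (simp add: turn_def)
  have side: "bent_side (i + 1) = bent_side i" if "i \<noteq> -1" for i
    using that by (auto simp: bent_side_def)
  show ?thesis
    unfolding framed_polygon_def
  proof (intro allI conjI)
    fix i :: int
    let ?p = "axis 1 1 :: real^3"
    have s: "of_int i * (pi / 4) + pi / 4 = of_int (i + 1) * (pi / 4)" by (simp add: algebra_simps)
    show "unit_tangent (bent_polygon i) (arc_tangent ?p (bent_side i) (of_int i * (pi / 4)))"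
      unfolding bent_polygon_def by (intro unit_tangent_arc fr)
    show "bent_polygon (i + 1) = arc_point (bent_polygon i) (arc_tangent ?p (bent_side i) (of_int i * (pi / 4))) (pi / 4)"
      unfolding bent_polygon_def move s using side[of i] by (cases "i = -1") (auto simp: arc_point_def)
    show "arc_tangent (bent_polygon i) (arc_tangent ?p (bent_side i) (of_int i * (pi / 4))) (pi / 4) =
       turn (bent_polygon (i + 1)) (if i + 1 = 0 then 1 else 0) (arc_tangent ?p (bent_side (i + 1)) (of_int (i + 1) * (pi / 4)))"
    proof (cases "i = -1")
      case True
      then show ?thesis unfolding bent_polygon_def move s by (simp add: b arc_point_def arc_tangent_def)
    next
      case False
      then show ?thesis unfolding bent_polygon_def move s using side[of i] by (simp add: turn0)
    qed
  qed (use pi_gt3 in auto)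
qed

theorem theorem3p4:
  shows "\<exists>(P0 :: int \<Rightarrow> real^3) (c :: real \<Rightarrow> real^3).
           geodesic_polygon P0 \<and> sbigs_limit_curve P0 c \<and>
           G1_continuous c \<and> \<not> G2_continuous c"
proof -
  note can = framed_polygon_canonical[OF bent_framed]
  interpret tame_start bent_polygon
  proof
    show "framed_polygon bent_polygon (edge_direction bent_polygon) (edge_length bent_polygon)
        (angular_defect bent_polygon)"
      using bent_framed unfolding can .
    show "controlled 0 (edge_length bent_polygon) (angular_defect bent_polygon)"
      by (simp add: controlled_def tan_45 flip: can)
  qed
  obtain c where c: "sbigs_limit_curve bent_polygon c" "G1_continuous c"
    "\<And>j i. c (of_int i / 2 ^ j) = sbigs bent_polygon j i"
    using limit_G1 by blast
  have "angular_defect (sbigs bent_polygon 0) i = (if i = 0 then 1 else 0)" for i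
    unfolding sbigs_def by (simp flip: can(3))
  then have "\<not> has_geodesic_curvature c 0 k" for k
    by (intro no_curvature c(3)) simp_all
  then have "\<not> G2_continuous c" unfolding G2_continuous_def by blast
  moreover have "geodesic_polygon bent_polygon"
    unfolding geodesic_polygon_def
  proof (intro allI conjI)
    fix i
    have P0: "sbigs bent_polygon 0 = bent_polygon" by (simp add: sbigs_def)
    note D = framedD[of 0, unfolded P0] length_lt_pi[of 0, unfolded P0]
    show "bent_polygon i \<in> sphere 0 1" using D(1)[of i] by (simp add: unit_tangent_def)
    show "bent_polygon i \<noteq> bent_polygon (i + 1)" "bent_polygon i \<noteq> - bent_polygon (i + 1)"
      unfolding D(5)[of i] using arc_point_distinct[OF D(1,2,7)] by metis+
  qed
  ultimately show ?thesis using c by blast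
qed

end
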